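(* Let $z\in\mathbb{C}\setminus\{-\alpha\}$ be such that $k(z)\neq0$. Let $\{\phi_m\psi_n\}_{m,n\in\mathbb{N}}$ (with $(\phi_m\psi_n)(x,y)=\phi_m(x)\psi_n(y)$) form a basis of $L^2(\Omega)$ such that, for some $\rho_m,\nu_n\in\mathbb{C}$ with $k^2(z)\ne\rho_m^2$ and $k^2(z)\ne\nu_n^2$, $$L(z)\phi_m\psi_n=(k^2(z)-\rho_m^2)(k^2(z)-\nu_n^2)\phi_m\psi_n\quad\text{and}\quad(K(z)L(z)-L(z)K(z))\phi_m\psi_n=0$$ for all $m,n\in\mathbb{N}$. If there exist $m,n\in\mathbb{N}$ for which $P_z(\rho_m,\nu_n)=0$, then $\Delta(z)\phi_m\psi_n=0$ and $z\in\sigma_p(A)$ with eigenvector $\phi_m\psi_n$. Otherwise, when $P_z(\rho_m,\nu_n)\ne0$ for all $m,n\in\mathbb{N}$, then $z\in\rho(A)$.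
   Context: Fix $a,b>0$, $\bar\Omega=[-a,a]\times[-b,b]$ with interior $\Omega$, and write $r=(x,y)\in\bar\Omega$, $\|r\|_1=|x|+|y|$. Let $Y=C(\bar\Omega)$ (continuous complex-valued functions, supremum norm). Fix reals $\alpha>0$, $\tau_0>0$, $S'(0)\ne0$ and complex numbers $\hat c\ne0$, $\xi$ such that $J(r,r')=\hat ce^{-\xi\|r-r'\|_1}$ is real-valued. Put $\tau_{max}=\tau_0+2a+2b$, $X=C([-\tau_{max},0];Y)$, and for $\varphi\in X$ $$(DG(0)\varphi)(r)=S'(0)\int_\Omega J(r,r')\varphi(-\tau_0-\|r-r'\|_1,r')\,dr'.$$ $A$ is the operator $A\varphi=\varphi'$ with domain $D(A)=\{\varphi\in X:\varphi'\in X,\ \varphi'(0)=-\alpha\varphi(0)+DG(0)\varphi\}$ (the generator of the solution semigroup of $\dot V(t)=-\alpha V(t)+DG(0)V_t$); $\rho(A)$ and $\sigma_p(A)$ are its resolvent set and point spectrum. For $z\in\mathbb{C}$ put $k(z)=z+\xi$, $c(z)=\hat cS'(0)e^{-\tau_0z}$ (so $c(z)\neq0$), $$(K(z)q)(r)=c(z)\int_\Omega e^{-k(z)\|r-r'\|_1}q(r')\,dr',\qquad\Delta(z)q=(z+\alpha)q-K(z)q,$$ $$L(z)q=\Bigl(k^2(z)-\frac{\partial^2}{\partial x^2}\Bigr)\Bigl(k^2(z)-\frac{\partial^2}{\partial y^2}\Bigr)q,\qquad P_z(\rho,\nu)=(z+\alpha)(k^2(z)-\rho^2)(k^2(z)-\nu^2)-4c(z)k^2(z).$$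 "$z\in\sigma_p(A)$ with eigenvector $q$" means $q\in Y$ is nonzero and $\varphi(t)(r)=e^{zt}q(r)$ is an eigenvector of $A$ with eigenvalue $z$; this is equivalent to $\Delta(z)q=0$, $q\neq0$. The functions $\phi_m\in C^2([-a,a])$, $\psi_n\in C^2([-b,b])$ are complex-valued. "Basis of $L^2(\Omega)$" means that every $f\in L^2(\Omega)$ has a unique expansion $f=\sum_{m,n}\xi_{m,n}\phi_m\psi_n$ with $\xi_{m,n}\in\mathbb{C}$, convergent in $L^2(\Omega)$. *)

theory Defs
  imports "HOL-Analysis.Analysis"
begin

section \<open>Domains and function spaces\<close>

definition Omega_bar :: "real \<Rightarrow> real \<Rightarrow> (real \<times> real) set" where
  "Omega_bar a b = {-a..a} \<times> {-b..b}"

definition Omega :: "real \<Rightarrow> real \<Rightarrow> (real \<times> real) set" where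
  "Omega a b = interior (Omega_bar a b)"

definition norm1 :: "real \<times> real \<Rightarrow> real" where
  "norm1 r = \<bar>fst r\<bar> + \<bar>snd r\<bar>"

text \<open>
  \<open>C(S; M)\<close> for a compact interval or rectangle \<open>S\<close> is the library space \<open>cfunspace\<close>, whose
  elements are the extensional continuous functions (value \<open>undefined\<close> off the domain) with the
  supremum distance.  All operators below therefore return functions restricted to the domain, so
  that equality of elements is plain equality, and the linear operations are pointwise operations
  followed by restriction.
\<close>

definition Y_space :: "real \<Rightarrow> real \<Rightarrow> (real \<times> real \<Rightarrow> complex) metric" where
  "Y_space a b = cfunspace (top_of_set (Omega_bar a b)) euclidean_metric"

definition zero_Y :: "real \<Rightarrow> real \<Rightarrow> real \<times> real \<Rightarrow> complex" where
  "zero_Y a b = (\<lambda>r\<in>Omega_bar a b. 0)"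

definition hist_interval :: "real \<Rightarrow> real \<Rightarrow> real \<Rightarrow> real set" where
  "hist_interval a b \<tau>\<^sub>0 = {-(\<tau>\<^sub>0 + 2 * a + 2 * b)..0}"

definition X_space :: "real \<Rightarrow> real \<Rightarrow> real \<Rightarrow> (real \<Rightarrow> real \<times> real \<Rightarrow> complex) metric" where
  "X_space a b \<tau>\<^sub>0 = cfunspace (top_of_set (hist_interval a b \<tau>\<^sub>0)) (Y_space a b)"

definition zero_X :: "real \<Rightarrow> real \<Rightarrow> real \<Rightarrow> real \<Rightarrow> real \<times> real \<Rightarrow> complex" where
  "zero_X a b \<tau>\<^sub>0 = (\<lambda>t\<in>hist_interval a b \<tau>\<^sub>0. zero_Y a b)"

definition norm_X :: "real \<Rightarrow> real \<Rightarrow> real \<Rightarrow> (real \<Rightarrow> real \<times> real \<Rightarrow> complex) \<Rightarrow> real" where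
  "norm_X a b \<tau>\<^sub>0 \<phi> = mdist (X_space a b \<tau>\<^sub>0) \<phi> (zero_X a b \<tau>\<^sub>0)"


section \<open>The generator and its spectrum\<close>

text \<open>The parameter \<open>s\<close> stands for \<open>S'(0)\<close> and \<open>ch\<close> for the coefficient c-hat.\<close>

definition J_kernel :: "complex \<Rightarrow> complex \<Rightarrow> real \<times> real \<Rightarrow> real \<times> real \<Rightarrow> complex" where
  "J_kernel ch \<xi> r r' = ch * exp (- \<xi> * of_real (norm1 (r - r')))"

definition DG0 :: "real \<Rightarrow> real \<Rightarrow> real \<Rightarrow> real \<Rightarrow> complex \<Rightarrow> complex \<Rightarrow>
    (real \<Rightarrow> real \<times> real \<Rightarrow> complex) \<Rightarrow> real \<times> real \<Rightarrow> complex" where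
  "DG0 a b \<tau>\<^sub>0 s ch \<xi> \<phi> = (\<lambda>r\<in>Omega_bar a b.
     of_real s * (LINT r'|lebesgue_on (Omega a b).
        J_kernel ch \<xi> r r' * \<phi> (- \<tau>\<^sub>0 - norm1 (r - r')) r'))"

text \<open>Derivative in the norm of \<open>Y\<close>; it is one-sided at the end points of the history interval.\<close>

definition has_X_derivative :: "real \<Rightarrow> real \<Rightarrow> real \<Rightarrow>
    (real \<Rightarrow> real \<times> real \<Rightarrow> complex) \<Rightarrow> (real \<Rightarrow> real \<times> real \<Rightarrow> complex) \<Rightarrow> bool" where
  "has_X_derivative a b \<tau>\<^sub>0 \<phi> \<psi> \<longleftrightarrow> (\<forall>t\<in>hist_interval a b \<tau>\<^sub>0.
     limitin (mtopology_of (Y_space a b))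
       (\<lambda>u. \<lambda>r\<in>Omega_bar a b. (\<phi> u r - \<phi> t r) / of_real (u - t)) (\<psi> t)
       (at t within hist_interval a b \<tau>\<^sub>0))"

definition dom_A :: "real \<Rightarrow> real \<Rightarrow> real \<Rightarrow> real \<Rightarrow> real \<Rightarrow> complex \<Rightarrow> complex \<Rightarrow>
    (real \<Rightarrow> real \<times> real \<Rightarrow> complex) set" where
  "dom_A a b \<alpha> \<tau>\<^sub>0 s ch \<xi> = {\<phi> \<in> mspace (X_space a b \<tau>\<^sub>0).
     \<exists>\<psi> \<in> mspace (X_space a b \<tau>\<^sub>0). has_X_derivative a b \<tau>\<^sub>0 \<phi> \<psi> \<and>
       \<psi> 0 = (\<lambda>r\<in>Omega_bar a b. - of_real \<alpha> * \<phi> 0 r + DG0 a b \<tau>\<^sub>0 s ch \<xi> \<phi> r)}"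

definition A_op :: "real \<Rightarrow> real \<Rightarrow> real \<Rightarrow>
    (real \<Rightarrow> real \<times> real \<Rightarrow> complex) \<Rightarrow> real \<Rightarrow> real \<times> real \<Rightarrow> complex" where
  "A_op a b \<tau>\<^sub>0 \<phi> = (THE \<psi>. \<psi> \<in> mspace (X_space a b \<tau>\<^sub>0) \<and> has_X_derivative a b \<tau>\<^sub>0 \<phi> \<psi>)"

definition eigenvector_A :: "real \<Rightarrow> real \<Rightarrow> real \<Rightarrow> real \<Rightarrow> real \<Rightarrow> complex \<Rightarrow> complex \<Rightarrow>
    complex \<Rightarrow> (real \<Rightarrow> real \<times> real \<Rightarrow> complex) \<Rightarrow> bool" where
  "eigenvector_A a b \<alpha> \<tau>\<^sub>0 s ch \<xi> z \<phi> \<longleftrightarrow>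
     \<phi> \<in> dom_A a b \<alpha> \<tau>\<^sub>0 s ch \<xi> \<and> \<phi> \<noteq> zero_X a b \<tau>\<^sub>0 \<and>
     A_op a b \<tau>\<^sub>0 \<phi> = (\<lambda>t\<in>hist_interval a b \<tau>\<^sub>0. \<lambda>r\<in>Omega_bar a b. z * \<phi> t r)"

definition point_spectrum_A :: "real \<Rightarrow> real \<Rightarrow> real \<Rightarrow> real \<Rightarrow> real \<Rightarrow> complex \<Rightarrow> complex \<Rightarrow>
    complex set" where
  "point_spectrum_A a b \<alpha> \<tau>\<^sub>0 s ch \<xi> = {z. \<exists>\<phi>. eigenvector_A a b \<alpha> \<tau>\<^sub>0 s ch \<xi> z \<phi>}"

text \<open>The meaning of \<open>z \<in> \<sigma>\<^sub>p(A)\<close> ``with eigenvector \<open>q\<close>'' for \<open>q \<in> Y\<close>.\<close>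

definition in_point_spectrum_with :: "real \<Rightarrow> real \<Rightarrow> real \<Rightarrow> real \<Rightarrow> real \<Rightarrow> complex \<Rightarrow> complex \<Rightarrow>
    complex \<Rightarrow> (real \<times> real \<Rightarrow> complex) \<Rightarrow> bool" where
  "in_point_spectrum_with a b \<alpha> \<tau>\<^sub>0 s ch \<xi> z q \<longleftrightarrow>
     z \<in> point_spectrum_A a b \<alpha> \<tau>\<^sub>0 s ch \<xi> \<and>
     q \<in> mspace (Y_space a b) \<and> q \<noteq> zero_Y a b \<and>
     eigenvector_A a b \<alpha> \<tau>\<^sub>0 s ch \<xi> z
       (\<lambda>t\<in>hist_interval a b \<tau>\<^sub>0. \<lambda>r\<in>Omega_bar a b. exp (z * of_real t) * q r)"

definition z_minus_A :: "real \<Rightarrow> real \<Rightarrow> real \<Rightarrow> complex \<Rightarrow>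
    (real \<Rightarrow> real \<times> real \<Rightarrow> complex) \<Rightarrow> real \<Rightarrow> real \<times> real \<Rightarrow> complex" where
  "z_minus_A a b \<tau>\<^sub>0 z \<phi> =
     (\<lambda>t\<in>hist_interval a b \<tau>\<^sub>0. \<lambda>r\<in>Omega_bar a b. z * \<phi> t r - A_op a b \<tau>\<^sub>0 \<phi> t r)"

text \<open>\<open>z - A : D(A) \<rightarrow> X\<close> is bijective with bounded inverse.\<close>

definition resolvent_set_A :: "real \<Rightarrow> real \<Rightarrow> real \<Rightarrow> real \<Rightarrow> real \<Rightarrow> complex \<Rightarrow> complex \<Rightarrow>
    complex set" where
  "resolvent_set_A a b \<alpha> \<tau>\<^sub>0 s ch \<xi> = {z.
     bij_betw (z_minus_A a b \<tau>\<^sub>0 z) (dom_A a b \<alpha> \<tau>\<^sub>0 s ch \<xi>) (mspace (X_space a b \<tau>\<^sub>0)) \<and>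
     (\<exists>M. \<forall>\<phi>\<in>dom_A a b \<alpha> \<tau>\<^sub>0 s ch \<xi>. norm_X a b \<tau>\<^sub>0 \<phi> \<le> M * norm_X a b \<tau>\<^sub>0 (z_minus_A a b \<tau>\<^sub>0 z \<phi>))}"


section \<open>Characteristic operator and associated differential operator\<close>

definition k_fun :: "complex \<Rightarrow> complex \<Rightarrow> complex" where
  "k_fun \<xi> z = z + \<xi>"

definition c_fun :: "real \<Rightarrow> real \<Rightarrow> complex \<Rightarrow> complex \<Rightarrow> complex" where
  "c_fun \<tau>\<^sub>0 s ch z = ch * of_real s * exp (- of_real \<tau>\<^sub>0 * z)"

definition K_op :: "real \<Rightarrow> real \<Rightarrow> real \<Rightarrow> real \<Rightarrow> complex \<Rightarrow> complex \<Rightarrow> complex \<Rightarrow>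
    (real \<times> real \<Rightarrow> complex) \<Rightarrow> real \<times> real \<Rightarrow> complex" where
  "K_op a b \<tau>\<^sub>0 s ch \<xi> z q = (\<lambda>r\<in>Omega_bar a b.
     c_fun \<tau>\<^sub>0 s ch z * (LINT r'|lebesgue_on (Omega a b).
        exp (- k_fun \<xi> z * of_real (norm1 (r - r'))) * q r'))"

definition Delta_op :: "real \<Rightarrow> real \<Rightarrow> real \<Rightarrow> real \<Rightarrow> real \<Rightarrow> complex \<Rightarrow> complex \<Rightarrow> complex \<Rightarrow>
    (real \<times> real \<Rightarrow> complex) \<Rightarrow> real \<times> real \<Rightarrow> complex" where
  "Delta_op a b \<alpha> \<tau>\<^sub>0 s ch \<xi> z q = (\<lambda>r\<in>Omega_bar a b.
     (z + of_real \<alpha>) * q r - K_op a b \<tau>\<^sub>0 s ch \<xi> z q r)"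

text \<open>
  Partial derivatives on the closed rectangle, one-sided on the boundary.  Where a derivative does
  not exist the value of \<open>vector_derivative\<close> is arbitrary; in the theorem \<open>L_op\<close> is only applied
  to functions for which all the derivatives involved exist.
\<close>

definition deriv_in :: "real set \<Rightarrow> (real \<Rightarrow> complex) \<Rightarrow> real \<Rightarrow> complex" where
  "deriv_in I f x = vector_derivative f (at x within I)"

definition dxx :: "real \<Rightarrow> (real \<times> real \<Rightarrow> complex) \<Rightarrow> real \<times> real \<Rightarrow> complex" where
  "dxx a q = (\<lambda>(x, y). deriv_in {-a..a} (deriv_in {-a..a} (\<lambda>u. q (u, y))) x)"

definition dyy :: "real \<Rightarrow> (real \<times> real \<Rightarrow> complex) \<Rightarrow> real \<times> real \<Rightarrow> complex" where
  "dyy b q = (\<lambda>(x, y). deriv_in {-b..b} (deriv_in {-b..b} (\<lambda>v. q (x, v))) y)"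

definition L_op :: "real \<Rightarrow> real \<Rightarrow> complex \<Rightarrow> complex \<Rightarrow>
    (real \<times> real \<Rightarrow> complex) \<Rightarrow> real \<times> real \<Rightarrow> complex" where
  "L_op a b \<xi> z q =
     (let Dx = (\<lambda>f. \<lambda>r\<in>Omega_bar a b. (k_fun \<xi> z)\<^sup>2 * f r - dxx a f r);
          Dy = (\<lambda>f. \<lambda>r\<in>Omega_bar a b. (k_fun \<xi> z)\<^sup>2 * f r - dyy b f r)
      in Dx (Dy q))"

definition P_fun :: "real \<Rightarrow> real \<Rightarrow> real \<Rightarrow> complex \<Rightarrow> complex \<Rightarrow> complex \<Rightarrow>
    complex \<Rightarrow> complex \<Rightarrow> complex" where
  "P_fun \<alpha> \<tau>\<^sub>0 s ch \<xi> z \<rho> \<nu> =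
     (z + of_real \<alpha>) * ((k_fun \<xi> z)\<^sup>2 - \<rho>\<^sup>2) * ((k_fun \<xi> z)\<^sup>2 - \<nu>\<^sup>2)
       - 4 * c_fun \<tau>\<^sub>0 s ch z * (k_fun \<xi> z)\<^sup>2"


section \<open>Product families and bases of the Lebesgue space\<close>

definition C2_on :: "real set \<Rightarrow> (real \<Rightarrow> complex) \<Rightarrow> bool" where
  "C2_on I f \<longleftrightarrow> (\<exists>f' f''.
     (\<forall>x\<in>I. (f has_vector_derivative f' x) (at x within I)) \<and>
     (\<forall>x\<in>I. (f' has_vector_derivative f'' x) (at x within I)) \<and>
     continuous_on I f'')"

definition tensor :: "real \<Rightarrow> real \<Rightarrow> (real \<Rightarrow> complex) \<Rightarrow> (real \<Rightarrow> complex) \<Rightarrow>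
    real \<times> real \<Rightarrow> complex" where
  "tensor a b f g = (\<lambda>r\<in>Omega_bar a b. f (fst r) * g (snd r))"

definition L2_on :: "(real \<times> real) set \<Rightarrow> (real \<times> real \<Rightarrow> complex) set" where
  "L2_on S = {f \<in> borel_measurable (lebesgue_on S).
     integrable (lebesgue_on S) (\<lambda>r. (norm (f r))\<^sup>2)}"

definition L2_norm_on :: "(real \<times> real) set \<Rightarrow> (real \<times> real \<Rightarrow> complex) \<Rightarrow> real" where
  "L2_norm_on S f = sqrt (LINT r|lebesgue_on S. (norm (f r))\<^sup>2)"

text \<open>
  Every \<open>f \<in> L\<^sup>2(S)\<close> has a unique expansion in the family \<open>e\<close>.  The filter \<open>F\<close> on finite index
  sets is the mode of summation: the partial sums over finite index sets converge along \<open>F\<close>, which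
  has to be finer than \<open>finite_subsets_at_top UNIV\<close>, that is, every index eventually takes part.
  For \<open>F = finite_subsets_at_top UNIV\<close> this is unconditional summation (as in \<open>has_sum\<close>); for a
  double series, \<open>filtermap (\<lambda>(M, N). {..<M} \<times> {..<N}) (at_top \<times>\<^sub>F at_top)\<close> gives rectangular partial
  sums, and \<open>filtermap (\<lambda>N. g ` {..<N}) sequentially\<close> the summation along an enumeration \<open>g\<close>.
  Elements of \<open>L\<^sup>2\<close> are represented by functions, equality in \<open>L\<^sup>2\<close> being distance zero.
\<close>

definition L2_basis :: "'i set filter \<Rightarrow> (real \<times> real) set \<Rightarrow>
    ('i \<Rightarrow> real \<times> real \<Rightarrow> complex) \<Rightarrow> bool" where
  "L2_basis F S e \<longleftrightarrow> F \<le> finite_subsets_at_top UNIV \<and> (\<forall>i. e i \<in> L2_on S) \<and>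
     (\<forall>f\<in>L2_on S. \<exists>!x :: 'i \<Rightarrow> complex.
        ((\<lambda>B. L2_norm_on S (\<lambda>r. f r - (\<Sum>i\<in>B. x i * e i r))) \<longlongrightarrow> 0) F)"

end

theory Submission
  imports Defs
begin

text \<open>
  Write \<open>k = k(z)\<close>, \<open>c = c(z)\<close>, \<open>K = K(z)\<close>, \<open>L = L(z)\<close> and let \<open>e = \<phi>\<^sub>m \<psi>\<^sub>n\<close> with
  \<open>L e = \<omega> e\<close>, \<open>\<omega> = (k\<^sup>2 - \<rho>\<^sub>m\<^sup>2) (k\<^sup>2 - \<nu>\<^sub>n\<^sup>2) \<noteq> 0\<close>.

  The function \<open>exp (- k \<bar>x\<bar>)\<close> is \<open>2 k\<close> times a fundamental solution of \<open>k\<^sup>2 - d\<^sup>2/dx\<^sup>2\<close>, and the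
  1-norm makes the kernel of \<open>K\<close> a product of two such functions.  So \<open>L\<close> is, up to the factor
  \<open>4 c k\<^sup>2\<close>, a left inverse of \<open>K\<close> on products (\<open>L_op_K_op_tensor\<close>).  Since \<open>K\<close> and \<open>L\<close> commute on
  \<open>e\<close>, we get \<open>\<omega> K e = K L e = L K e = 4 c k\<^sup>2 e\<close>.  Thus \<open>e\<close> is an eigenfunction of \<open>K\<close> for
  \<open>\<theta> = 4 c k\<^sup>2 / \<omega>\<close> (\<open>K_op_eigenfunction\<close>), and \<open>\<Delta>(z) e = (z + \<alpha> - \<theta>) e\<close>, where
  \<open>z + \<alpha> - \<theta> = P\<^sub>z(\<rho>\<^sub>m, \<nu>\<^sub>n) / \<omega>\<close>.  A zero of \<open>P\<^sub>z\<close> therefore gives a solution of the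
  characteristic equation \<open>\<Delta>(z) q = 0\<close>, and \<open>exp (z t) q\<close> is then an eigenvector of \<open>A\<close>
  (\<open>eigenvector_if_characteristic_equation\<close>).

  If \<open>P\<^sub>z\<close> has no zero among the pairs, \<open>\<Delta>(z)\<close> is diagonal with nonzero entries in the basis.
  Applying \<open>\<Delta>(z)\<close>, which is bounded for the \<open>L\<^sup>2\<close> norm, to the expansion of a continuous solution of
  \<open>\<Delta>(z) q = 0\<close> gives an expansion of zero; its coefficients vanish by uniqueness, hence so does \<open>q\<close>
  (\<open>injective_if_diagonal_on_L2_basis\<close>).  Because \<open>z + \<alpha> \<noteq> 0\<close> and \<open>K\<close> is compact on the continuous
  functions, injectivity of \<open>\<Delta>(z)\<close> gives a bounded inverse (\<open>fredholm_alternative_kernel\<close>).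

  Finally the equation \<open>(z - A) \<phi> = f\<close> is a linear differential equation in the history variable, so
  that by variation of constants \<open>\<phi>(t) = exp (z t) q + h\<^sub>f(t)\<close> with \<open>q = \<phi>(0)\<close> and an explicit \<open>h\<^sub>f\<close>.
  The boundary condition in the domain of \<open>A\<close> becomes \<open>\<Delta>(z) q = f(0) + DG(0) h\<^sub>f\<close>
  (\<open>dom_A_representation\<close>, \<open>dom_A_construction\<close>).  Bounded invertibility of \<open>\<Delta>(z)\<close> thus passes to
  \<open>z - A\<close> (\<open>resolvent_set_if_characteristic_equation_solvable\<close>).
\<close>

section \<open>The Fredholm alternative for uniform limits of finite-rank operators\<close>

text \<open>
  Building up one rank-one operator at a time makes the two properties used below, a range inside the
  span of a finite set and compactness, immediate inductions.
\<close>

inductive finite_rank :: "('a::real_normed_vector \<Rightarrow> 'b::real_normed_vector) \<Rightarrow> bool" where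
  zero: "finite_rank (\<lambda>x. 0)"
| add_rank_one: "finite_rank T \<Longrightarrow> bounded_linear l \<Longrightarrow> finite_rank (\<lambda>x. T x + l x *\<^sub>R v)"

lemma finite_rank_bounded_linear: "finite_rank T \<Longrightarrow> bounded_linear T"
  by (induction rule: finite_rank.induct)
     (auto intro!: bounded_linear_add bounded_linear_scaleR_const)

lemma finite_rank_range_span:
  assumes "finite_rank T"
  shows "\<exists>B. finite B \<and> range T \<subseteq> span B"
  using assms
proof induction
  case zero
  show ?case by (rule exI[of _ "{}"]) auto
next
  case (add_rank_one T l v)
  then obtain B where B: "finite B" "range T \<subseteq> span B" by blast
  have "T x + l x *\<^sub>R v \<in> span (insert v B)" for x
    using B(2) span_mono[OF subset_insertI, of B v]
    by (intro span_add span_scale) (auto intro: span_base)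
  with B(1) show ?case by (intro exI[of _ "insert v B"]) auto
qed

text \<open>
  The Bolzano-Weierstrass theorem, applied to the bounded scalar coefficients one after the other.
\<close>

lemma finite_rank_compact:
  fixes x :: "nat \<Rightarrow> 'a::real_normed_vector"
  assumes "finite_rank T" and "bounded (range x)"
  shows "\<exists>r::nat \<Rightarrow> nat. strict_mono r \<and> convergent (\<lambda>n. T (x (r n)))"
  using assms(1)
proof induction
  case zero
  show ?case by (rule exI[of _ id]) (auto simp: strict_mono_def intro: convergent_const)
next
  case (add_rank_one T l v)
  then obtain r :: "nat \<Rightarrow> nat" where r: "strict_mono r" "convergent (\<lambda>n. T (x (r n)))" by blast
  have "bounded (l ` range x)"
    using bounded_linear_image[OF assms(2) add_rank_one.hyps(2)] .
  then have "bounded (range (\<lambda>n. l (x (r n))))"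
    by (rule bounded_subset) auto
  then obtain c s where s: "strict_mono s" "((\<lambda>n. l (x (r n))) \<circ> s) \<longlonglongrightarrow> c"
    using bounded_imp_convergent_subsequence by blast
  have "convergent (\<lambda>n. T (x (r (s n))))"
    using convergent_subseq_convergent[OF r(2) s(1)] by (simp add: o_def)
  moreover have "convergent (\<lambda>n. l (x (r (s n))) *\<^sub>R v)"
    using tendsto_scaleR[OF s(2) tendsto_const[of v]] by (auto simp: o_def convergent_def)
  ultimately have "convergent (\<lambda>n. T (x (r (s n))) + l (x (r (s n))) *\<^sub>R v)"
    by (rule convergent_add)
  with strict_mono_o[OF r(1) s(1)] show ?case
    by (intro exI[of _ "r \<circ> s"]) (auto simp: o_def)
qed

text \<open>
  The rank argument for endomorphisms of a finite-dimensional space, for a finite-dimensional subspace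
  of a space of arbitrary dimension: the image of a basis of the span is independent and has the
  cardinality of the basis, so that no vector of the span lies outside the span of the image.
\<close>

lemma linear_inj_on_span_surj:
  fixes f :: "'a::real_vector \<Rightarrow> 'a"
  assumes f: "linear f" and B: "finite B" and into: "f ` span B \<subseteq> span B"
    and inj: "\<And>x. x \<in> span B \<Longrightarrow> f x = 0 \<Longrightarrow> x = 0"
  shows "span B \<subseteq> f ` span B"
proof -
  obtain C where C: "C \<subseteq> B" "independent C" "span C = span B"
    by (metis basis_exists span_superset span_eq order.trans)
  have fC: "finite C" using C(1) B finite_subset by blast
  have injC: "inj_on f (span C)"
    using inj C(3) by (simp add: linear_inj_on_span_iff_independent_image linear_injective_on_subspace_0[OF f])
  have ind: "independent (f ` C)"
    using linear_independent_injective_image[OF f C(2)] injC by blast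
  have card: "card (f ` C) = card C"
    by (rule card_image) (use injC span_superset[of C] inj_on_subset in blast)
  have fCC: "f ` C \<subseteq> span C" using into C(3) span_superset[of C] by auto
  have "c \<in> span (f ` C)" if "c \<in> C" for c
  proof (rule ccontr)
    assume c: "c \<notin> span (f ` C)"
    then have "independent (insert c (f ` C))" by (rule independent_insertI[OF _ ind])
    moreover have "insert c (f ` C) \<subseteq> span C" using fCC that by (simp add: span_base)
    ultimately have "card (insert c (f ` C)) \<le> card C" using independent_span_bound[OF fC, of "insert c (f ` C)"] by simp
    moreover have "c \<notin> f ` C" using c span_base[of c "f ` C"] by argo
    ultimately show False using fC card by simp
  qed
  then have "span C \<subseteq> span (f ` C)" by (intro span_minimal subspace_span) auto
  then show ?thesis using linear_span_image[OF f, of C] C(3) by simp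
qed

text \<open>
  Split \<open>T = F + R\<close> with \<open>F\<close> of finite rank and \<open>R\<close> a contraction.  Then \<open>I - R\<close> has an inverse
  \<open>G\<close>, and \<open>x - T x = y\<close> is equivalent to \<open>x - G (F x) = G y\<close>, an equation for the finite-rank operator
  \<open>G F\<close>; there injectivity implies surjectivity by linear algebra.  The bound for the inverse is the
  usual compactness argument, with the convergent subsequence again provided by \<open>F\<close>.
\<close>

theorem fredholm_alternative:
  fixes T :: "'a::banach \<Rightarrow> 'a"
  assumes T: "bounded_linear T"
    and approx: "\<And>e. e > 0 \<Longrightarrow> \<exists>F. finite_rank F \<and> (\<forall>x. norm (T x - F x) \<le> e * norm x)"
    and inj: "\<And>x. T x = x \<Longrightarrow> x = 0"
  shows "\<exists>M. \<forall>y. \<exists>x. x - T x = y \<and> norm x \<le> M * norm y"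
proof -
  obtain F where F: "finite_rank F" and TF: "\<And>x. norm (T x - F x) \<le> 1/2 * norm x"
    using approx[of "1/2"] by auto
  define R where "R x = T x - F x" for x
  interpret T: bounded_linear T by (rule T)
  interpret F: bounded_linear F by (rule finite_rank_bounded_linear[OF F])
  interpret R: bounded_linear R unfolding R_def[abs_def]
    by (rule bounded_linear_sub[OF T finite_rank_bounded_linear[OF F]])
  have R: "norm (R x) \<le> 1/2 * norm x" for x using TF by (simp add: R_def)
  have "\<exists>x. x - R x = y" for y
  proof -
    have "\<exists>!x. R x + y = x"
      by (rule banach_fix_type[of "1/2"]) (use R in \<open>auto simp: dist_norm simp flip: R.diff\<close>)
    then show ?thesis by (metis add_diff_cancel_left')
  qed
  then obtain G where G: "G y - R (G y) = y" for y by metis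
  have nG: "norm x \<le> 2 * norm (x - R x)" for x
    using R[of x] norm_triangle_ineq2[of x "R x"] by simp
  have Guniq: "G (x - R x) = x" for x
    using nG[of "G (x - R x) - x"] G[of "x - R x"] by (simp add: R.diff algebra_simps)
  have linG: "linear G"
  proof (rule linearI)
    show "G (x + y) = G x + G y" for x y
    proof -
      have "(G x + G y) - R (G x + G y) = (G x - R (G x)) + (G y - R (G y))" by (simp add: R.add)
      then show ?thesis using Guniq[of "G x + G y"] by (simp only: G)
    qed
    show "G (c *\<^sub>R x) = c *\<^sub>R G x" for c x
    proof -
      have "c *\<^sub>R G x - R (c *\<^sub>R G x) = c *\<^sub>R (G x - R (G x))"
        by (simp add: R.scaleR scaleR_diff_right)
      then show ?thesis using Guniq[of "c *\<^sub>R G x"] by (simp only: G)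
    qed
  qed
  have bl: "bounded_linear G"
  proof (rule bounded_linear_intro[of _ 2])
    show "norm (G x) \<le> norm x * 2" for x using nG[of "G x"] by (simp only: G mult.commute)
  qed (use linG in \<open>auto simp: linear_add linear_scale\<close>)
  obtain B where B: "finite B" "range F \<subseteq> span B" using finite_rank_range_span[OF F] by blast
  define H where "H x = G (F x)" for x
  have linH: "linear H" unfolding H_def[abs_def]
    using linear_compose[OF F.linear linG] by (simp add: o_def)
  have solve: "x - T x = y" if "x - H x = G y" for x y
  proof -
    have *: "x = G (F x + y)" using that linear_add[OF linG] by (simp add: H_def diff_eq_eq add.commute)
    have "x - R x = F x + y" using G[of "F x + y"] by (simp only: *[symmetric])
    then show ?thesis by (simp add: R_def algebra_simps)
  qed
  have Hinj: "x = 0" if "x - H x = 0" for x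
    using solve[of x 0] that inj[of x] linear_0[OF linG] by simp
  have HV: "H x \<in> span (G ` B)" for x
    using B(2) linear_span_image[OF linG, of B] by (auto simp: H_def)
  have lin: "linear (\<lambda>x. x - H x)" by (intro linear_compose_sub linear_ident linH)
  have surjV: "span (G ` B) \<subseteq> (\<lambda>x. x - H x) ` span (G ` B)"
    by (rule linear_inj_on_span_surj[OF lin]) (use B(1) HV Hinj in \<open>auto intro!: span_diff\<close>)
  have ex: "\<exists>x. x - T x = y" for y
  proof -
    from subsetD[OF surjV HV[of "G y"]] obtain v where v: "H (G y) = v - H v" by (elim imageE) simp
    have "(G y + v) - H (G y + v) = G y" using v by (simp add: linear_add[OF linH] algebra_simps)
    then show ?thesis by (intro exI[of _ "G y + v"] solve)
  qed
  have "\<exists>M. \<forall>x. norm x \<le> M * norm (x - T x)"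
  proof (rule ccontr)
    assume "\<not> ?thesis"
    \<comment> \<open>Normalised vectors \<open>x n\<close> with \<open>x n - T (x n)\<close> tending to zero would, along a subsequence, converge
      to a unit vector fixed by \<open>T\<close>.\<close>
    then have "\<forall>n. \<exists>x. norm x > real (Suc n) * norm (x - T x)" by (meson not_le)
    then obtain w where w: "\<And>n. norm (w n) > real (Suc n) * norm (w n - T (w n))" by metis
    define x where "x n = (1 / norm (w n)) *\<^sub>R w n" for n
    have w0: "norm (w n) > 0" for n
      by (rule le_less_trans[OF _ w[of n]]) simp
    have nx: "norm (x n) = 1" for n using w0[of n] by (simp add: x_def)
    have small: "norm (x n - T (x n)) \<le> inverse (real (Suc n))" for n
    proof -
      have "x n - T (x n) = (1 / norm (w n)) *\<^sub>R (w n - T (w n))"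
        by (simp add: x_def T.scaleR scaleR_diff_right)
      then have "norm (x n - T (x n)) = norm (w n - T (w n)) / norm (w n)" by simp
      then have "real (Suc n) * norm (x n - T (x n)) = (real (Suc n) * norm (w n - T (w n))) / norm (w n)"
        by simp
      also have "\<dots> \<le> 1" using w[of n] w0[of n] by (simp del: of_nat_Suc)
      finally show ?thesis by (simp add: inverse_eq_divide field_simps del: of_nat_Suc)
    qed
    have null: "(\<lambda>n. x n - T (x n)) \<longlonglongrightarrow> 0"
      by (rule Lim_null_comparison[OF _ LIMSEQ_inverse_real_of_nat]) (use small in auto)
    have "bounded (range x)" by (rule boundedI[of _ 1]) (use nx in auto)
    from finite_rank_compact[OF F this] obtain r f where r: "strict_mono r"
      and f: "(\<lambda>n. F (x (r n))) \<longlonglongrightarrow> f" by (auto simp: convergent_def)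
    have null': "(\<lambda>n. x (r n) - T (x (r n))) \<longlonglongrightarrow> 0"
      using LIMSEQ_subseq_LIMSEQ[OF null r] by (simp add: o_def)
    have "(\<lambda>n. x (r n) - R (x (r n))) \<longlonglongrightarrow> f"
      using tendsto_add[OF null' f] by (simp add: R_def algebra_simps)
    from bounded_linear.tendsto[OF bl this] have lim: "(\<lambda>n. x (r n)) \<longlonglongrightarrow> G f"
      by (simp add: Guniq)
    have "(\<lambda>n. x (r n) - T (x (r n))) \<longlonglongrightarrow> G f - T (G f)"
      by (intro tendsto_diff lim T.tendsto)
    from LIMSEQ_unique[OF this null'] have "G f = 0" by (intro inj) simp
    moreover have "norm (G f) = 1"
      using tendsto_norm[OF lim] by (simp add: nx LIMSEQ_const_iff)
    ultimately show False by simp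
  qed
  then obtain M where M: "\<And>x. norm x \<le> M * norm (x - T x)" by blast
  show ?thesis by (rule exI[of _ M]) (metis M ex)
qed

section \<open>Integral operators with a continuous kernel\<close>

instance bcontfun :: (metric_space, banach) banach ..

lemma Omega_bar_cbox: "Omega_bar a b = cbox (-a, -b) (a, b)"
  by (simp add: Omega_bar_def cbox_Pair_eq)

lemma integrable_Omega:
  fixes f :: "real \<times> real \<Rightarrow> 'c::euclidean_space"
  assumes "continuous_on (Omega_bar a b) f"
  shows "integrable (lebesgue_on (Omega a b)) f"
proof -
  have "set_integrable lebesgue (cbox (-a, -b) (a, b)) f"
    using continuous_imp_integrable[OF assms[unfolded Omega_bar_cbox]]
    by (simp add: integrable_restrict_space set_integrable_def)
  then have "set_integrable lebesgue (box (-a, -b) (a, b)) f"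
    by (rule set_integrable_subset) (auto simp: box_subset_cbox)
  then show ?thesis
    by (simp add: Omega_def Omega_bar_cbox interior_cbox integrable_restrict_space set_integrable_def)
qed

lemma integral_Omega:
  fixes f :: "real \<times> real \<Rightarrow> 'c::euclidean_space"
  assumes "continuous_on (Omega_bar a b) f"
  shows "(LINT r|lebesgue_on (Omega a b). f r) = integral (Omega_bar a b) f"
proof -
  have "(LINT r|lebesgue_on (Omega a b). f r) = integral (Omega a b) f"
    by (rule lebesgue_integral_eq_integral[OF integrable_Omega[OF assms]]) (simp add: Omega_def)
  then show ?thesis
    by (simp add: Omega_def Omega_bar_cbox interior_cbox integral_open_interval)
qed

text \<open>
  Bounded continuous functions on the whole space form a Banach space type.  Evaluating the kernel at
  the point of the box nearest to \<open>r\<close> turns an integral operator on \<open>C(cbox l u)\<close> into an operator on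
  that type without changing its values on the box.
\<close>

definition kernel_op :: "'a::euclidean_space \<Rightarrow> 'a \<Rightarrow> ('a \<times> 'a \<Rightarrow> complex) \<Rightarrow>
    ('a \<Rightarrow>\<^sub>C complex) \<Rightarrow> ('a \<Rightarrow>\<^sub>C complex)" where
  "kernel_op l u \<kappa> f =
     Bcontfun (\<lambda>r. integral (cbox l u) (\<lambda>r'. \<kappa> (clamp l u r, r') * apply_bcontfun f r'))"

definition clamp_ext :: "'a::euclidean_space \<Rightarrow> 'a \<Rightarrow> ('a \<Rightarrow> 'b::metric_space) \<Rightarrow> 'a \<Rightarrow>\<^sub>C 'b" where
  "clamp_ext l u f = Bcontfun (\<lambda>r. f (clamp l u r))"

lemma clamp_ext_apply:
  assumes "continuous_on (cbox l u) f"
  shows "apply_bcontfun (clamp_ext l u f) r = f (clamp l u r)"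
proof -
  have "(\<lambda>r. f (clamp l u r)) \<in> bcontfun"
    unfolding bcontfun_def
    using clamp_continuous_on[OF assms] clamp_bounded[of f l u]
      compact_imp_bounded[OF compact_continuous_image[OF assms compact_cbox]] by auto
  then show ?thesis by (simp add: clamp_ext_def Bcontfun_inverse)
qed

lemma continuous_on_slice:
  assumes "continuous_on (A \<times> B) \<kappa>" "r \<in> A"
  shows "continuous_on B (\<lambda>r'. \<kappa> (r, r'))"
  by (rule continuous_on_compose2[OF assms(1)]) (use assms(2) in \<open>auto intro!: continuous_intros\<close>)

lemma continuous_on_kernel_integral:
  fixes \<kappa> :: "'a::euclidean_space \<times> 'a \<Rightarrow> complex"
  assumes "continuous_on (A \<times> cbox l u) \<kappa>" "continuous_on (cbox l u) f"
  shows "continuous_on A (\<lambda>r. integral (cbox l u) (\<lambda>r'. \<kappa> (r, r') * f r'))"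
proof -
  have "continuous_on (A \<times> cbox l u) (\<lambda>p. \<kappa> p * f (snd p))"
    by (intro continuous_on_mult assms continuous_on_compose2[OF assms(2)] continuous_on_snd continuous_on_id) auto
  then show ?thesis
    by (intro integral_continuous_on_param) (auto simp: case_prod_unfold)
qed

lemma continuous_on_bcontfun: "continuous_on A (apply_bcontfun f)"
  using apply_bcontfun[of f] by (auto simp: bcontfun_def intro: continuous_on_subset)

context
  fixes l u :: "'a::euclidean_space"
  assumes ne: "cbox l u \<noteq> {}"
begin

lemma clamp_in: "clamp l u r \<in> cbox l u"
  using ne by (intro clamp_in_interval) (auto simp: box_ne_empty)

lemma kernel_op_apply:
  assumes "continuous_on (cbox l u \<times> cbox l u) \<kappa>"
  shows "apply_bcontfun (kernel_op l u \<kappa> f) r =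
    integral (cbox l u) (\<lambda>r'. \<kappa> (clamp l u r, r') * apply_bcontfun f r')"
  using clamp_ext_apply[OF continuous_on_kernel_integral[OF assms continuous_on_bcontfun[of _ f]]]
  by (simp add: clamp_ext_def kernel_op_def)

lemma kernel_op_integrable:
  fixes \<kappa> :: "'a \<times> 'a \<Rightarrow> complex"
  assumes "continuous_on (cbox l u \<times> cbox l u) \<kappa>"
  shows "(\<lambda>r'. \<kappa> (clamp l u r, r') * apply_bcontfun f r') integrable_on cbox l u"
proof (rule integrable_continuous)
  show "continuous_on (cbox l u) (\<lambda>r'. \<kappa> (clamp l u r, r') * apply_bcontfun f r')"
    by (rule continuous_on_mult[OF continuous_on_slice[OF assms clamp_in] continuous_on_bcontfun])
qed

lemma kernel_op_norm_le:
  assumes "continuous_on (cbox l u \<times> cbox l u) \<kappa>"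
    and "\<And>p. p \<in> cbox l u \<times> cbox l u \<Longrightarrow> norm (\<kappa> p) \<le> B"
  shows "norm (kernel_op l u \<kappa> f) \<le> B * measure lborel (cbox l u) * norm f"
proof (rule norm_bound)
  fix r
  have B: "0 \<le> B" using assms(2)[of "(clamp l u r, clamp l u r)"] clamp_in norm_ge_zero order_trans
    by blast
  have "norm (integral (cbox l u) (\<lambda>r'. \<kappa> (clamp l u r, r') * apply_bcontfun f r'))
      \<le> (B * norm f) * measure lborel (cbox l u)"
  proof (rule has_integral_bound[OF _ integrable_integral[OF kernel_op_integrable[OF assms(1)]]])
    show "0 \<le> B * norm f" using B by simp
    show "\<And>x. x \<in> cbox l u \<Longrightarrow> norm (\<kappa> (clamp l u r, x) * apply_bcontfun f x) \<le> B * norm f"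
      using assms(2) clamp_in norm_bounded[of f] B by (auto simp: norm_mult intro!: mult_mono)
  qed
  then show "norm (apply_bcontfun (kernel_op l u \<kappa> f) r) \<le> B * measure lborel (cbox l u) * norm f"
    by (simp add: kernel_op_apply[OF assms(1)] mult_ac)
qed

lemma kernel_op_add:
  assumes "continuous_on (cbox l u \<times> cbox l u) \<kappa>\<^sub>1" "continuous_on (cbox l u \<times> cbox l u) \<kappa>\<^sub>2"
  shows "kernel_op l u (\<lambda>p. \<kappa>\<^sub>1 p + \<kappa>\<^sub>2 p) f = kernel_op l u \<kappa>\<^sub>1 f + kernel_op l u \<kappa>\<^sub>2 f"
proof (rule bcontfun_eqI)
  fix r
  show "apply_bcontfun (kernel_op l u (\<lambda>p. \<kappa>\<^sub>1 p + \<kappa>\<^sub>2 p) f) r =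
      apply_bcontfun (kernel_op l u \<kappa>\<^sub>1 f + kernel_op l u \<kappa>\<^sub>2 f) r"
    using integral_add[OF kernel_op_integrable[OF assms(1), of r f] kernel_op_integrable[OF assms(2), of r f]]
    by (simp add: kernel_op_apply assms continuous_on_add plus_bcontfun.rep_eq distrib_right)
qed

lemma bounded_linear_kernel_op:
  assumes \<kappa>: "continuous_on (cbox l u \<times> cbox l u) \<kappa>"
  shows "bounded_linear (kernel_op l u \<kappa>)"
proof -
  obtain B where "\<And>p. p \<in> cbox l u \<times> cbox l u \<Longrightarrow> norm (\<kappa> p) \<le> B"
    using compact_imp_bounded[OF compact_continuous_image[OF \<kappa> compact_Times[OF compact_cbox compact_cbox]]]
    by (auto simp: bounded_iff)
  note B = kernel_op_norm_le[OF \<kappa> this]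
  show ?thesis
  proof (rule bounded_linear_intro[of _ "B * measure lborel (cbox l u)"])
    show "kernel_op l u \<kappa> (f + g) = kernel_op l u \<kappa> f + kernel_op l u \<kappa> g" for f g
    proof (rule bcontfun_eqI)
      fix r show "apply_bcontfun (kernel_op l u \<kappa> (f + g)) r =
          apply_bcontfun (kernel_op l u \<kappa> f + kernel_op l u \<kappa> g) r"
        using integral_add[OF kernel_op_integrable[OF \<kappa>, of r f] kernel_op_integrable[OF \<kappa>, of r g]]
        by (simp add: kernel_op_apply \<kappa> plus_bcontfun.rep_eq distrib_left)
    qed
    show "kernel_op l u \<kappa> (c *\<^sub>R f) = c *\<^sub>R kernel_op l u \<kappa> f" for c f
      by (rule bcontfun_eqI) (simp add: kernel_op_apply \<kappa> scaleR_bcontfun.rep_eq)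
    show "norm (kernel_op l u \<kappa> f) \<le> norm f * (B * measure lborel (cbox l u))" for f
      using B by (simp add: mult.commute)
  qed
qed

end

text \<open>
  Finite sums \<open>\<Sum>\<^sub>i v\<^sub>i(r) w\<^sub>i(r')\<close>; the operators with such kernels are of finite rank.
\<close>

inductive separable_kernel ::
    "('a::topological_space \<times> 'b::topological_space \<Rightarrow> complex) \<Rightarrow> bool" where
  zero: "separable_kernel (\<lambda>p. 0)"
| add_product: "separable_kernel \<kappa> \<Longrightarrow> continuous_on UNIV v \<Longrightarrow> continuous_on UNIV w \<Longrightarrow>
    separable_kernel (\<lambda>p. \<kappa> p + v (fst p) * w (snd p))"

lemma separable_kernel_product:
  assumes "continuous_on UNIV v" "continuous_on UNIV w"
  shows "separable_kernel (\<lambda>p. v (fst p) * w (snd p))"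
  using add_product[OF zero assms] by simp

lemma separable_kernel_continuous: "separable_kernel \<kappa> \<Longrightarrow> continuous_on A \<kappa>"
proof (induction rule: separable_kernel.induct)
  case (add_product \<kappa> v w)
  then show ?case
    by (intro continuous_on_add continuous_on_mult)
       (auto intro!: continuous_on_compose2[of UNIV v] continuous_on_compose2[of UNIV w] continuous_intros)
qed simp

lemma separable_kernel_add:
  assumes "separable_kernel \<kappa>\<^sub>1" "separable_kernel \<kappa>\<^sub>2"
  shows "separable_kernel (\<lambda>p. \<kappa>\<^sub>1 p + \<kappa>\<^sub>2 p)"
  using assms(2)
proof induction
  case (add_product \<kappa> v w)
  from separable_kernel.add_product[OF add_product.IH add_product.hyps(2,3)] show ?case
    by (simp add: add.assoc)
qed (simp add: assms(1))

lemma separable_kernel_mult_product: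
  assumes "separable_kernel \<kappa>" "continuous_on UNIV v" "continuous_on UNIV w"
  shows "separable_kernel (\<lambda>p. \<kappa> p * (v (fst p) * w (snd p)))"
  using assms(1)
proof induction
  case (add_product \<kappa> v' w')
  have "separable_kernel (\<lambda>p. \<kappa> p * (v (fst p) * w (snd p)) +
      (v' (fst p) * v (fst p)) * (w' (snd p) * w (snd p)))"
    by (rule separable_kernel.add_product)
       (intro add_product continuous_on_mult assms)+
  then show ?case by (simp add: algebra_simps)
qed (simp add: zero)

lemma separable_kernel_mult:
  assumes "separable_kernel \<kappa>\<^sub>1" "separable_kernel \<kappa>\<^sub>2"
  shows "separable_kernel (\<lambda>p. \<kappa>\<^sub>1 p * \<kappa>\<^sub>2 p)"
  using assms(2)
proof induction
  case (add_product \<kappa> v w)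
  from separable_kernel_add[OF add_product.IH
      separable_kernel_mult_product[OF assms(1) add_product.hyps(2,3)]] show ?case
    by (simp add: algebra_simps)
qed (simp add: zero)

text \<open>
  A bounded linear form on a product splits as \<open>p (r, 0) + p (0, r')\<close>, and separable kernels are closed
  under sums and products.
\<close>

lemma separable_kernel_polynomial:
  fixes p :: "'a::real_normed_vector \<times> 'b::real_normed_vector \<Rightarrow> real"
  assumes "real_polynomial_function p"
  shows "separable_kernel (\<lambda>x. complex_of_real (p x))"
  using assms
proof induction
  case (linear p)
  interpret bounded_linear p by fact
  have "separable_kernel (\<lambda>x::'a\<times>'b. complex_of_real (p (fst x, 0)) * 1 + 1 * complex_of_real (p (0, snd x)))"
    by (intro separable_kernel_add separable_kernel_product[where v="\<lambda>x. complex_of_real (p (x, 0))" and w="\<lambda>_. 1"]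
       separable_kernel_product[where w="\<lambda>x. complex_of_real (p (0, x))" and v="\<lambda>_. 1"])
       (auto intro!: continuous_intros continuous_on)
  moreover have "complex_of_real (p (fst x, 0)) * 1 + 1 * complex_of_real (p (0, snd x)) = of_real (p x)" for x
    by (simp flip: of_real_add add)
  ultimately show ?case by simp
next
  case (const c)
  show ?case using separable_kernel_product[of "\<lambda>_. of_real c" "\<lambda>_. 1"] by simp
next
  case (add f g)
  then show ?case by (simp add: separable_kernel_add)
next
  case (mult f g)
  then show ?case by (simp add: separable_kernel_mult)
qed

lemma separable_kernel_approx:
  fixes \<kappa> :: "'a::euclidean_space \<times> 'b::euclidean_space \<Rightarrow> complex"
  assumes "compact S" "continuous_on S \<kappa>" "e > 0"
  obtains \<kappa>' where "separable_kernel \<kappa>'" "\<And>p. p \<in> S \<Longrightarrow> norm (\<kappa> p - \<kappa>' p) \<le> e"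
proof -
  obtain f where f: "real_polynomial_function f" "\<And>x. x \<in> S \<Longrightarrow> \<bar>Re (\<kappa> x) - f x\<bar> < e/2"
    using Stone_Weierstrass_real_polynomial_function[OF assms(1) continuous_on_Re[OF assms(2)], of "e/2"] assms(3) by auto
  obtain g where g: "real_polynomial_function g" "\<And>x. x \<in> S \<Longrightarrow> \<bar>Im (\<kappa> x) - g x\<bar> < e/2"
    using Stone_Weierstrass_real_polynomial_function[OF assms(1) continuous_on_Im[OF assms(2)], of "e/2"] assms(3) by auto
  have "separable_kernel (\<lambda>p. complex_of_real (f p) + complex_of_real (g p) * (\<i> * 1))"
    by (intro separable_kernel_add separable_kernel_polynomial f(1)
        separable_kernel_mult_product[where v="\<lambda>_. \<i>" and w="\<lambda>_. 1"] g(1) continuous_on_const)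
  moreover have "norm (\<kappa> p - (complex_of_real (f p) + complex_of_real (g p) * (\<i> * 1))) \<le> e" if "p \<in> S" for p
    using cmod_le[of "\<kappa> p - (complex_of_real (f p) + complex_of_real (g p) * (\<i> * 1))"]
      f(2)[OF that] g(2)[OF that] by simp
  ultimately show ?thesis using that by blast
qed

text \<open>
  A complex product kernel \<open>v(r) w(r')\<close> has real rank at most two: its operator maps \<open>f\<close> to
  \<open>Re (I f) v + Im (I f) \<i> v\<close> with \<open>I f = \<integral> w f\<close>.
\<close>

lemma finite_rank_kernel_op:
  fixes l u :: "'a::euclidean_space"
  assumes ne: "cbox l u \<noteq> {}" and "separable_kernel \<kappa>"
  shows "finite_rank (kernel_op l u \<kappa>)"
  using assms(2)
proof induction
  case zero
  have "kernel_op l u (\<lambda>p. 0) = (\<lambda>f. 0)"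
    by (intro ext bcontfun_eqI) (simp add: kernel_op_apply[OF ne] zero_bcontfun.rep_eq)
  then show ?case by (simp add: finite_rank.zero)
next
  case (add_product \<kappa> v w)
  define I where "I f = integral (cbox l u) (\<lambda>r'. w r' * apply_bcontfun f r')" for f
  have w: "continuous_on A w" for A using add_product.hyps(3) continuous_on_subset by blast
  have v: "continuous_on A v" for A using add_product.hyps(2) continuous_on_subset by blast
  have int: "(\<lambda>r'. w r' * apply_bcontfun f r') integrable_on cbox l u" for f
    by (intro integrable_continuous continuous_on_mult w continuous_on_bcontfun)
  obtain B where B: "\<And>r. r \<in> cbox l u \<Longrightarrow> norm (w r) \<le> B"
    using compact_imp_bounded[OF compact_continuous_image[OF w compact_cbox[of l u]]]
    by (auto simp: bounded_iff)
  have B0: "0 \<le> B" using B ne norm_ge_zero order_trans by (metis all_not_in_conv)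
  have I: "bounded_linear I"
  proof (rule bounded_linear_intro[of _ "B * measure lborel (cbox l u)"])
    show "I (f + g) = I f + I g" for f g
      using integral_add[OF int[of f] int[of g]] by (simp add: I_def plus_bcontfun.rep_eq distrib_left)
    show "I (c *\<^sub>R f) = c *\<^sub>R I f" for c f
      by (simp add: I_def scaleR_bcontfun.rep_eq)
    show "norm (I f) \<le> norm f * (B * measure lborel (cbox l u))" for f
    proof -
      have "norm (I f) \<le> (B * norm f) * measure lborel (cbox l u)"
        unfolding I_def
      proof (rule has_integral_bound[OF _ integrable_integral[OF int]])
        show "0 \<le> B * norm f" using B0 by simp
        show "\<And>x. x \<in> cbox l u \<Longrightarrow> norm (w x * apply_bcontfun f x) \<le> B * norm f"
          using B norm_bounded[of f] B0 by (auto simp: norm_mult intro!: mult_mono)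
      qed
      then show ?thesis by (simp add: mult_ac)
    qed
  qed
  have c: "continuous_on (cbox l u \<times> cbox l u) (\<lambda>p. v (fst p) * w (snd p))"
    by (intro separable_kernel_continuous separable_kernel_product v w)
  have "kernel_op l u (\<lambda>p. \<kappa> p + v (fst p) * w (snd p)) =
      (\<lambda>f. (kernel_op l u \<kappa> f + Re (I f) *\<^sub>R clamp_ext l u v) + Im (I f) *\<^sub>R clamp_ext l u (\<lambda>r. \<i> * v r))"
  proof (intro ext bcontfun_eqI)
    fix f r
    have "v (clamp l u r) * I f = Re (I f) *\<^sub>R v (clamp l u r) + Im (I f) *\<^sub>R (\<i> * v (clamp l u r))"
      by (simp add: complex_eq_iff algebra_simps)
    moreover have "apply_bcontfun (kernel_op l u (\<lambda>p. v (fst p) * w (snd p)) f) r = v (clamp l u r) * I f"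
      by (simp add: kernel_op_apply[OF ne c] I_def mult.assoc)
    ultimately show "apply_bcontfun (kernel_op l u (\<lambda>p. \<kappa> p + v (fst p) * w (snd p)) f) r =
        apply_bcontfun ((kernel_op l u \<kappa> f + Re (I f) *\<^sub>R clamp_ext l u v) + Im (I f) *\<^sub>R clamp_ext l u (\<lambda>r. \<i> * v r)) r"
      by (simp add: kernel_op_add[OF ne separable_kernel_continuous[OF add_product.hyps(1)] c]
          plus_bcontfun.rep_eq scaleR_bcontfun.rep_eq clamp_ext_apply v continuous_on_mult)
  qed
  moreover have "finite_rank \<dots>"
    by (intro finite_rank.add_rank_one add_product.IH bounded_linear_compose[OF bounded_linear_Re I]
        bounded_linear_compose[OF bounded_linear_Im I])
  ultimately show ?case by simp
qed

text \<open>
  By Stone-Weierstrass the kernel is a uniform limit of separable ones, so the abstract alternative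
  applies to \<open>K / \<mu>\<close>.  The constant \<open>M\<close> is a bound for the inverse of \<open>\<mu> - K\<close> in the supremum norm.
\<close>

theorem fredholm_alternative_kernel:
  fixes l u :: "'a::euclidean_space" and \<kappa> :: "'a \<times> 'a \<Rightarrow> complex"
  assumes ne: "cbox l u \<noteq> {}" and \<kappa>: "continuous_on (cbox l u \<times> cbox l u) \<kappa>" and "\<mu> \<noteq> 0"
    and inj: "\<And>q r. continuous_on (cbox l u) q \<Longrightarrow>
      (\<And>r. r \<in> cbox l u \<Longrightarrow> \<mu> * q r = integral (cbox l u) (\<lambda>r'. \<kappa> (r, r') * q r')) \<Longrightarrow>
      r \<in> cbox l u \<Longrightarrow> q r = 0"
  shows "\<exists>M. \<forall>g C. continuous_on (cbox l u) g \<longrightarrow> (\<forall>r\<in>cbox l u. norm (g r) \<le> C) \<longrightarrow>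
    (\<exists>q. continuous_on (cbox l u) q \<and> (\<forall>r\<in>cbox l u. norm (q r) \<le> M * C) \<and>
      (\<forall>r\<in>cbox l u. \<mu> * q r - integral (cbox l u) (\<lambda>r'. \<kappa> (r, r') * q r') = g r))"
proof -
  define k where "k p = \<kappa> p / \<mu>" for p
  define T where "T = kernel_op l u k"
  have k: "continuous_on (cbox l u \<times> cbox l u) k"
    unfolding k_def using \<kappa> \<open>\<mu> \<noteq> 0\<close> by (intro continuous_intros) auto
  have T: "apply_bcontfun (T f) r =
      integral (cbox l u) (\<lambda>r'. \<kappa> (clamp l u r, r') * apply_bcontfun f r') / \<mu>" for f r
    by (simp add: T_def kernel_op_apply[OF ne k] k_def)
  have "\<exists>M. \<forall>y. \<exists>x. x - T x = y \<and> norm x \<le> M * norm y"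
  proof (rule fredholm_alternative)
    show "bounded_linear T" unfolding T_def by (rule bounded_linear_kernel_op[OF ne k])
    show "\<exists>F. finite_rank F \<and> (\<forall>x. norm (T x - F x) \<le> e * norm x)" if "e > 0" for e
    proof -
      \<comment> \<open>The summand 1 covers boxes of volume zero.\<close>
      define d where "d = e / (measure lborel (cbox l u) + 1)"
      have c0: "measure lborel (cbox l u) + 1 > 0" by (simp add: add_nonneg_pos)
      then have d: "d > 0" "d * measure lborel (cbox l u) \<le> e"
        using that by (simp_all add: d_def pos_divide_le_eq mult_left_mono del: measure_lborel_cbox_eq)
      obtain k' where k': "separable_kernel k'"
        "\<And>p. p \<in> cbox l u \<times> cbox l u \<Longrightarrow> norm (k p - k' p) \<le> d"
        using separable_kernel_approx[OF compact_Times[OF compact_cbox compact_cbox] k d(1)] by blast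
      have c: "continuous_on (cbox l u \<times> cbox l u) k'"
        "continuous_on (cbox l u \<times> cbox l u) (\<lambda>p. k p - k' p)"
        by (intro continuous_on_diff k separable_kernel_continuous k'(1))+
      have "norm (T f - kernel_op l u k' f) \<le> e * norm f" for f
      proof -
        have "T f - kernel_op l u k' f = kernel_op l u (\<lambda>p. k p - k' p) f"
          using kernel_op_add[OF ne c(2,1), of f] by (simp add: T_def)
        then have "norm (T f - kernel_op l u k' f) \<le> d * measure lborel (cbox l u) * norm f"
          using kernel_op_norm_le[OF ne c(2) k'(2), of f] by simp
        also have "\<dots> \<le> e * norm f" using d by (intro mult_right_mono) auto
        finally show ?thesis .
      qed
      then show ?thesis using finite_rank_kernel_op[OF ne k'(1)] by blast
    qed
    show "f = 0" if "T f = f" for f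
    proof -
      have *: "\<mu> * apply_bcontfun f r = integral (cbox l u) (\<lambda>r'. \<kappa> (clamp l u r, r') * apply_bcontfun f r')" for r
        using T[of f r] that \<open>\<mu> \<noteq> 0\<close> by (simp add: field_simps)
      \<comment> \<open>The hypothesis applies on the box; the values of \<open>f\<close> elsewhere are integrals over the box.\<close>
      have 0: "apply_bcontfun f r = 0" if "r \<in> cbox l u" for r
        by (rule inj[OF continuous_on_bcontfun _ that]) (use * in auto)
      have "apply_bcontfun f r = 0" for r
      proof -
        have "integral (cbox l u) (\<lambda>r'. \<kappa> (clamp l u r, r') * apply_bcontfun f r') = integral (cbox l u) (\<lambda>r'. 0)"
          by (rule integral_cong) (simp add: 0)
        with *[of r] \<open>\<mu> \<noteq> 0\<close> show ?thesis by simp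
      qed
      then show ?thesis by (intro bcontfun_eqI) (simp add: zero_bcontfun.rep_eq)
    qed
  qed
  then obtain M where M: "\<And>y. \<exists>x. x - T x = y \<and> norm x \<le> M * norm y" by blast
  have "\<exists>q. continuous_on (cbox l u) q \<and> (\<forall>r\<in>cbox l u. norm (q r) \<le> (\<bar>M\<bar> / norm \<mu>) * C) \<and>
      (\<forall>r\<in>cbox l u. \<mu> * q r - integral (cbox l u) (\<lambda>r'. \<kappa> (r, r') * q r') = g r)"
    if g: "continuous_on (cbox l u) g" and C: "\<forall>r\<in>cbox l u. norm (g r) \<le> C" for g C
  proof -
    have cg: "continuous_on (cbox l u) (\<lambda>r. g r / \<mu>)" using g \<open>\<mu> \<noteq> 0\<close> by (intro continuous_intros) auto
    obtain x where x: "x - T x = clamp_ext l u (\<lambda>r. g r / \<mu>)"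
      "norm x \<le> M * norm (clamp_ext l u (\<lambda>r. g r / \<mu>))" using M by blast
    have n: "norm (clamp_ext l u (\<lambda>r. g r / \<mu>)) \<le> C / norm \<mu>"
      by (rule norm_bound)
        (use C clamp_in[OF ne] \<open>\<mu> \<noteq> 0\<close> in \<open>auto simp: clamp_ext_apply[OF cg] norm_divide divide_right_mono\<close>)
    have "norm x \<le> \<bar>M\<bar> * norm (clamp_ext l u (\<lambda>r. g r / \<mu>))"
      using x(2) by (rule order_trans) (simp add: mult_right_mono)
    also have "\<dots> \<le> \<bar>M\<bar> * (C / norm \<mu>)" using n by (intro mult_left_mono) auto
    finally have nx: "norm x \<le> (\<bar>M\<bar> / norm \<mu>) * C" by simp
    have "\<mu> * apply_bcontfun x r - integral (cbox l u) (\<lambda>r'. \<kappa> (r, r') * apply_bcontfun x r') = g r"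
      if "r \<in> cbox l u" for r
    proof -
      have "apply_bcontfun (x - T x) r = g r / \<mu>" using that by (simp add: x(1) clamp_ext_apply[OF cg])
      then show ?thesis using that \<open>\<mu> \<noteq> 0\<close> by (simp add: minus_bcontfun.rep_eq T field_simps)
    qed
    moreover have "norm (apply_bcontfun x r) \<le> (\<bar>M\<bar> / norm \<mu>) * C" for r
      using norm_bounded[of x r] nx by (rule order_trans)
    ultimately show ?thesis by (intro exI[of _ "apply_bcontfun x"]) (auto intro: continuous_on_bcontfun)
  qed
  then show ?thesis by blast
qed

section \<open>The eigenvalues of the exponential integral operator on products\<close>

text \<open>
  Splitting the integral at \<open>x\<close> gives
  \<open>U(x) = exp (- k x) \<integral>\<^sub>-\<^sub>a\<^sup>x exp (k t) f(t) dt + exp (k x) \<integral>\<^sub>x\<^sup>a exp (- k t) f(t) dt\<close>.  In the first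
  derivative the boundary terms cancel; in the second they add up to \<open>- 2 k f(x)\<close>.
\<close>

lemma has_two_derivatives_exp_convolution:
  fixes f :: "real \<Rightarrow> complex" and k :: complex and a :: real
  defines "U \<equiv> \<lambda>x. integral {-a..a} (\<lambda>t. exp (- k * of_real \<bar>x - t\<bar>) * f t)"
  assumes f: "continuous_on {-a..a} f"
  obtains U' where
    "\<And>x. x \<in> {-a..a} \<Longrightarrow> (U has_vector_derivative U' x) (at x within {-a..a})"
    "\<And>x. x \<in> {-a..a} \<Longrightarrow> (U' has_vector_derivative k\<^sup>2 * U x - 2 * k * f x) (at x within {-a..a})"
proof -
  define p where "p t = exp (k * of_real t) * f t" for t
  define m where "m t = exp (- k * of_real t) * f t" for t
  have p: "continuous_on {-a..a} p" and m: "continuous_on {-a..a} m"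
    unfolding p_def m_def by (intro continuous_intros f)+
  define P where "P x = integral {-a..x} p" for x
  define Q where "Q x = integral {-a..a} m - integral {-a..x} m" for x
  define U' where "U' x = k * (exp (k * of_real x) * Q x - exp (- k * of_real x) * P x)" for x
  have U: "U x = exp (- k * of_real x) * P x + exp (k * of_real x) * Q x" if x: "x \<in> {-a..a}" for x
  proof -
    have c: "continuous_on {-a..a} (\<lambda>t. exp (- k * of_real \<bar>x - t\<bar>) * f t)"
      by (intro continuous_intros f)
    have "U x = integral {-a..x} (\<lambda>t. exp (- k * of_real \<bar>x - t\<bar>) * f t) +
        integral {x..a} (\<lambda>t. exp (- k * of_real \<bar>x - t\<bar>) * f t)"
      unfolding U_def
      by (rule Henstock_Kurzweil_Integration.integral_combine[symmetric])
        (use x c in \<open>auto intro: integrable_continuous_interval\<close>)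
    also have "integral {-a..x} (\<lambda>t. exp (- k * of_real \<bar>x - t\<bar>) * f t) =
        integral {-a..x} (\<lambda>t. exp (- k * of_real x) * p t)"
      by (rule integral_cong) (simp add: p_def algebra_simps flip: exp_add)
    also have "integral {x..a} (\<lambda>t. exp (- k * of_real \<bar>x - t\<bar>) * f t) =
        integral {x..a} (\<lambda>t. exp (k * of_real x) * m t)"
      by (rule integral_cong) (simp add: m_def algebra_simps flip: exp_add)
    also have "integral {x..a} (\<lambda>t. exp (k * of_real x) * m t) = exp (k * of_real x) * Q x"
    proof -
      have "integral {-a..x} m + integral {x..a} m = integral {-a..a} m"
        by (rule Henstock_Kurzweil_Integration.integral_combine)
          (use x m in \<open>auto intro: integrable_continuous_interval\<close>)
      then have "integral {x..a} m = Q x" by (simp add: Q_def eq_diff_eq add.commute)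
      then show ?thesis by simp
    qed
    finally show ?thesis by (simp add: P_def)
  qed
  have P': "(P has_vector_derivative p x) (at x within {-a..a})" if "x \<in> {-a..a}" for x
    unfolding P_def using integral_has_vector_derivative[OF p that] .
  have Q': "(Q has_vector_derivative - m x) (at x within {-a..a})" if "x \<in> {-a..a}" for x
    unfolding Q_def using has_vector_derivative_diff[OF has_vector_derivative_const
      integral_has_vector_derivative[OF m that]] by simp
  have E: "((\<lambda>x. exp (c * of_real x)) has_vector_derivative c * exp (c * of_real x)) (at x within S)"
    for c :: complex and x S
    by (rule has_vector_derivative_real_field) (auto intro!: derivative_eq_intros)
  have one: "exp (- (k * complex_of_real x)) * exp (k * complex_of_real x) = 1" for x
    by (simp flip: exp_add)
  show ?thesis
  proof (rule that[of U'])
    fix x assume x: "x \<in> {-a..a}"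
    have "((\<lambda>x. exp (- k * of_real x) * P x + exp (k * of_real x) * Q x) has_vector_derivative
       (exp (- k * of_real x) * p x + - k * exp (- k * of_real x) * P x) +
       (exp (k * of_real x) * (- m x) + k * exp (k * of_real x) * Q x)) (at x within {-a..a})"
      by (intro has_vector_derivative_add has_vector_derivative_mult E P' Q' x)
    also have "(exp (- k * of_real x) * p x + - k * exp (- k * of_real x) * P x) +
       (exp (k * of_real x) * (- m x) + k * exp (k * of_real x) * Q x) = U' x"
      using one[of x] by (simp add: U'_def p_def m_def algebra_simps)
    finally show "(U has_vector_derivative U' x) (at x within {-a..a})"
      by (rule has_vector_derivative_transform[OF x U, rotated])
    have "(U' has_vector_derivative k * (
       (exp (k * of_real x) * (- m x) + k * exp (k * of_real x) * Q x) -
       (exp (- k * of_real x) * p x + - k * exp (- k * of_real x) * P x))) (at x within {-a..a})"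
      unfolding U'_def
      by (intro has_vector_derivative_mult_right has_vector_derivative_diff has_vector_derivative_mult E P' Q' x)
    also have "k * ((exp (k * of_real x) * (- m x) + k * exp (k * of_real x) * Q x) -
       (exp (- k * of_real x) * p x + - k * exp (- k * of_real x) * P x)) = k\<^sup>2 * U x - 2 * k * f x"
    proof -
      have "exp (k * of_real x) * m x = (exp (- (k * of_real x)) * exp (k * of_real x)) * f x"
        "exp (- k * of_real x) * p x = (exp (- (k * of_real x)) * exp (k * of_real x)) * f x"
        by (simp_all add: p_def m_def mult_ac)
      then have fm: "exp (k * of_real x) * m x = f x" "exp (- k * of_real x) * p x = f x"
        by (simp_all only: one mult_1)
      have "k * ((exp (k * of_real x) * (- m x) + k * exp (k * of_real x) * Q x) -
          (exp (- k * of_real x) * p x + - k * exp (- k * of_real x) * P x)) =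
          k\<^sup>2 * (exp (- k * of_real x) * P x + exp (k * of_real x) * Q x)
          - k * (exp (k * of_real x) * m x) - k * (exp (- k * of_real x) * p x)"
        by (simp add: power2_eq_square algebra_simps)
      also have "\<dots> = k\<^sup>2 * U x - 2 * k * f x" unfolding fm U[OF x] by simp
      finally show ?thesis .
    qed
    finally show "(U' has_vector_derivative k\<^sup>2 * U x - 2 * k * f x) (at x within {-a..a})" .
  qed
qed

text \<open>
  The function \<open>g\<close> has to agree with \<open>f\<close> on the interval only, as one-sided derivatives do not see the
  values outside.
\<close>

lemma deriv_in_twice:
  assumes "a > 0" "x \<in> {-a..a}"
    and f': "\<And>x. x \<in> {-a..a} \<Longrightarrow> (f has_vector_derivative f' x) (at x within {-a..a})"
    and f'': "\<And>x. x \<in> {-a..a} \<Longrightarrow> (f' has_vector_derivative f'' x) (at x within {-a..a})"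
    and g: "\<And>x. x \<in> {-a..a} \<Longrightarrow> g x = f x"
  shows "deriv_in {-a..a} (deriv_in {-a..a} g) x = f'' x"
proof -
  have D: "deriv_in {-a..a} h y = h'" if "(h has_vector_derivative h') (at y within {-a..a})" "y \<in> {-a..a}"
    for h h' y
    using vector_derivative_within_cbox[of "-a" a y h h'] that \<open>a > 0\<close> by (simp add: deriv_in_def)
  have g': "deriv_in {-a..a} g y = f' y" if "y \<in> {-a..a}" for y
    by (rule D[OF has_vector_derivative_transform[OF that g f'[OF that]] that])
  show ?thesis
    by (rule D[OF has_vector_derivative_transform[OF assms(2) g' f''[OF assms(2)]] assms(2)])
qed

lemma L_op_tensor:
  assumes "a > 0" "b > 0"
    and f: "\<And>x. x \<in> {-a..a} \<Longrightarrow> (f has_vector_derivative f' x) (at x within {-a..a})"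
       "\<And>x. x \<in> {-a..a} \<Longrightarrow> (f' has_vector_derivative f'' x) (at x within {-a..a})"
    and g: "\<And>y. y \<in> {-b..b} \<Longrightarrow> (g has_vector_derivative g' y) (at y within {-b..b})"
       "\<And>y. y \<in> {-b..b} \<Longrightarrow> (g' has_vector_derivative g'' y) (at y within {-b..b})"
  shows "L_op a b \<xi> z (tensor a b f g) =
    tensor a b (\<lambda>x. (k_fun \<xi> z)\<^sup>2 * f x - f'' x) (\<lambda>y. (k_fun \<xi> z)\<^sup>2 * g y - g'' y)"
proof -
  let ?k = "(k_fun \<xi> z)\<^sup>2"
  have Dy: "(\<lambda>r\<in>Omega_bar a b. ?k * tensor a b f g r - dyy b (tensor a b f g) r) =
      tensor a b f (\<lambda>y. ?k * g y - g'' y)"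
  proof
    fix r show "(\<lambda>r\<in>Omega_bar a b. ?k * tensor a b f g r - dyy b (tensor a b f g) r) r =
      tensor a b f (\<lambda>y. ?k * g y - g'' y) r"
    proof (cases "r \<in> Omega_bar a b")
      case True
      then obtain x y where r: "r = (x, y)" "x \<in> {-a..a}" "y \<in> {-b..b}" by (auto simp: Omega_bar_def)
      have "dyy b (tensor a b f g) r = f x * g'' y"
        unfolding dyy_def r(1) case_prod_conv
        by (rule deriv_in_twice[where f="\<lambda>y. f x * g y" and f'="\<lambda>y. f x * g' y"])
          (use \<open>b > 0\<close> r g in \<open>auto simp: tensor_def Omega_bar_def intro!: has_vector_derivative_mult_right\<close>)
      then show ?thesis using True r by (simp add: tensor_def algebra_simps)
    qed (simp add: tensor_def)
  qed
  let ?h = "\<lambda>y. ?k * g y - g'' y"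
  have Dx: "(\<lambda>r\<in>Omega_bar a b. ?k * tensor a b f ?h r - dxx a (tensor a b f ?h) r) =
      tensor a b (\<lambda>x. ?k * f x - f'' x) ?h"
  proof
    fix r show "(\<lambda>r\<in>Omega_bar a b. ?k * tensor a b f ?h r - dxx a (tensor a b f ?h) r) r =
      tensor a b (\<lambda>x. ?k * f x - f'' x) ?h r"
    proof (cases "r \<in> Omega_bar a b")
      case True
      then obtain x y where r: "r = (x, y)" "x \<in> {-a..a}" "y \<in> {-b..b}" by (auto simp: Omega_bar_def)
      have "dxx a (tensor a b f ?h) r = f'' x * ?h y"
        unfolding dxx_def r(1) case_prod_conv
        by (rule deriv_in_twice[where f="\<lambda>x. f x * ?h y" and f'="\<lambda>x. f' x * ?h y"])
          (use \<open>a > 0\<close> r f in \<open>auto simp: tensor_def Omega_bar_def intro!: has_vector_derivative_mult_left\<close>)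
      then show ?thesis using True r by (simp add: tensor_def algebra_simps)
    qed (simp add: tensor_def)
  qed
  show ?thesis unfolding L_op_def Let_def Dy Dx ..
qed

definition exp_kernel :: "complex \<Rightarrow> complex \<Rightarrow> (real \<times> real) \<times> (real \<times> real) \<Rightarrow> complex" where
  "exp_kernel c k p = c * exp (- k * of_real (norm1 (fst p - snd p)))"

lemma continuous_on_exp_kernel: "continuous_on S (exp_kernel c k)"
  unfolding exp_kernel_def norm1_def by (intro continuous_intros)

lemma K_op_eq:
  assumes q: "continuous_on (Omega_bar a b) q" and r: "r \<in> Omega_bar a b"
  shows "K_op a b \<tau>\<^sub>0 s ch \<xi> z q r =
    integral (Omega_bar a b) (\<lambda>r'. exp_kernel (c_fun \<tau>\<^sub>0 s ch z) (k_fun \<xi> z) (r, r') * q r')"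
proof -
  have "(LINT r'|lebesgue_on (Omega a b). exp (- k_fun \<xi> z * of_real (norm1 (r - r'))) * q r') =
      integral (Omega_bar a b) (\<lambda>r'. exp (- k_fun \<xi> z * of_real (norm1 (r - r'))) * q r')"
    by (rule integral_Omega) (auto simp: norm1_def intro!: continuous_intros q)
  then show ?thesis using r
    by (simp add: K_op_def exp_kernel_def mult.assoc)
qed

lemma continuous_on_tensor:
  assumes "continuous_on {-a..a} f" "continuous_on {-b..b} g"
  shows "continuous_on (Omega_bar a b) (tensor a b f g)"
proof -
  have "continuous_on (Omega_bar a b) (\<lambda>r. f (fst r) * g (snd r))"
    by (intro continuous_on_mult continuous_on_compose2[OF assms(1)] continuous_on_compose2[OF assms(2)]
      continuous_intros) (auto simp: Omega_bar_def)
  then show ?thesis by (rule continuous_on_cong[THEN iffD1, rotated 2]) (auto simp: tensor_def)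
qed

lemma K_op_tensor:
  assumes f: "continuous_on {-a..a} f" and g: "continuous_on {-b..b} g"
  shows "K_op a b \<tau>\<^sub>0 s ch \<xi> z (tensor a b f g) =
    tensor a b (\<lambda>x. c_fun \<tau>\<^sub>0 s ch z * integral {-a..a} (\<lambda>t. exp (- k_fun \<xi> z * of_real \<bar>x - t\<bar>) * f t))
      (\<lambda>y. integral {-b..b} (\<lambda>t. exp (- k_fun \<xi> z * of_real \<bar>y - t\<bar>) * g t))" (is "_ = ?rhs")
proof
  fix r show "K_op a b \<tau>\<^sub>0 s ch \<xi> z (tensor a b f g) r = ?rhs r"
  proof (cases "r \<in> Omega_bar a b")
    case True
    let ?c = "c_fun \<tau>\<^sub>0 s ch z" and ?k = "k_fun \<xi> z"
    obtain x y where r: "r = (x, y)" by force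
    let ?F = "\<lambda>t. exp (- ?k * of_real \<bar>x - t\<bar>) * f t" and ?G = "\<lambda>t. exp (- ?k * of_real \<bar>y - t\<bar>) * g t"
    have "integral (Omega_bar a b) (\<lambda>r'. exp_kernel ?c ?k (r, r') * tensor a b f g r') =
        integral (Omega_bar a b) (\<lambda>r'. ?c * (?F (fst r') * ?G (snd r')))"
      by (rule integral_cong) (simp add: exp_kernel_def tensor_def norm1_def r algebra_simps flip: exp_add)
    also have "\<dots> = ?c * integral (Omega_bar a b) (\<lambda>r'. ?F (fst r') * ?G (snd r'))" by simp
    also have "integral (Omega_bar a b) (\<lambda>r'. ?F (fst r') * ?G (snd r')) =
        integral (cbox (-a) a) (\<lambda>t. integral (cbox (-b) b) (\<lambda>t'. ?F t * ?G t'))"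
      unfolding Omega_bar_cbox
      by (subst integral_prod_continuous)
         (auto simp: cbox_Pair_eq intro!: continuous_intros continuous_on_compose2[OF f] continuous_on_compose2[OF g])
    also have "\<dots> = integral {-a..a} ?F * integral {-b..b} ?G" by simp
    also have "?c * (integral {-a..a} ?F * integral {-b..b} ?G) = ?rhs r"
      using True by (simp add: tensor_def r mult.assoc)
    finally show ?thesis
      unfolding K_op_eq[OF continuous_on_tensor[OF f g] True] .
  qed (simp add: K_op_def tensor_def)
qed

text \<open>
  Both factors of \<open>K e\<close> are convolutions with the exponential kernel, and \<open>k\<^sup>2 - d\<^sup>2/dx\<^sup>2\<close> sends each
  of them back to \<open>2 k\<close> times the factor of \<open>e\<close>.
\<close>

lemma L_op_K_op_tensor:
  assumes "a > 0" "b > 0"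
    and f: "continuous_on {-a..a} f" and g: "continuous_on {-b..b} g" and r: "r \<in> Omega_bar a b"
  shows "L_op a b \<xi> z (K_op a b \<tau>\<^sub>0 s ch \<xi> z (tensor a b f g)) r =
    4 * c_fun \<tau>\<^sub>0 s ch z * (k_fun \<xi> z)\<^sup>2 * tensor a b f g r"
proof -
  let ?c = "c_fun \<tau>\<^sub>0 s ch z" and ?k = "k_fun \<xi> z"
  let ?U = "\<lambda>x. integral {-a..a} (\<lambda>t. exp (- ?k * of_real \<bar>x - t\<bar>) * f t)"
  let ?V = "\<lambda>y. integral {-b..b} (\<lambda>t. exp (- ?k * of_real \<bar>y - t\<bar>) * g t)"
  obtain U' where U: "\<And>x. x \<in> {-a..a} \<Longrightarrow> (?U has_vector_derivative U' x) (at x within {-a..a})"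
    "\<And>x. x \<in> {-a..a} \<Longrightarrow> (U' has_vector_derivative ?k\<^sup>2 * ?U x - 2 * ?k * f x) (at x within {-a..a})"
    using has_two_derivatives_exp_convolution[OF f, of ?k] by blast
  obtain V' where V: "\<And>y. y \<in> {-b..b} \<Longrightarrow> (?V has_vector_derivative V' y) (at y within {-b..b})"
    "\<And>y. y \<in> {-b..b} \<Longrightarrow> (V' has_vector_derivative ?k\<^sup>2 * ?V y - 2 * ?k * g y) (at y within {-b..b})"
    using has_two_derivatives_exp_convolution[OF g, of ?k] by blast
  have "L_op a b \<xi> z (K_op a b \<tau>\<^sub>0 s ch \<xi> z (tensor a b f g)) =
      tensor a b (\<lambda>x. ?k\<^sup>2 * (?c * ?U x) - ?c * (?k\<^sup>2 * ?U x - 2 * ?k * f x))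
        (\<lambda>y. ?k\<^sup>2 * ?V y - (?k\<^sup>2 * ?V y - 2 * ?k * g y))"
    unfolding K_op_tensor[OF f g]
    by (rule L_op_tensor[OF assms(1,2), where f'="\<lambda>x. ?c * U' x" and g'=V'])
       (intro has_vector_derivative_mult_right U V; assumption)+
  then show ?thesis using r by (simp add: tensor_def power2_eq_square algebra_simps)
qed

text \<open>
  On \<open>e\<close> the two orders of composition give \<open>K L e = \<omega> K e\<close> and \<open>L K e = 4 c k\<^sup>2 e\<close>.
\<close>

lemma K_op_eigenfunction:
  assumes "a > 0" "b > 0"
    and f: "continuous_on {-a..a} f" and g: "continuous_on {-b..b} g" and "\<omega> \<noteq> 0"
    and L: "L_op a b \<xi> z (tensor a b f g) = (\<lambda>r\<in>Omega_bar a b. \<omega> * tensor a b f g r)"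
    and comm: "(\<lambda>r\<in>Omega_bar a b.
             K_op a b \<tau>\<^sub>0 s ch \<xi> z (L_op a b \<xi> z (tensor a b f g)) r
           - L_op a b \<xi> z (K_op a b \<tau>\<^sub>0 s ch \<xi> z (tensor a b f g)) r) = zero_Y a b"
    and r: "r \<in> Omega_bar a b"
  shows "K_op a b \<tau>\<^sub>0 s ch \<xi> z (tensor a b f g) r =
    4 * c_fun \<tau>\<^sub>0 s ch z * (k_fun \<xi> z)\<^sup>2 / \<omega> * tensor a b f g r"
proof -
  let ?K = "K_op a b \<tau>\<^sub>0 s ch \<xi> z" and ?q = "tensor a b f g"
  have q: "continuous_on (Omega_bar a b) ?q" by (rule continuous_on_tensor[OF f g])
  have "continuous_on (Omega_bar a b) (\<lambda>r\<in>Omega_bar a b. \<omega> * ?q r)"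
    by (rule continuous_on_cong[THEN iffD1, OF refl _ continuous_on_mult[OF continuous_on_const[of _ \<omega>] q]]) simp
  then have "?K (\<lambda>r\<in>Omega_bar a b. \<omega> * ?q r) r = integral (Omega_bar a b)
      (\<lambda>r'. exp_kernel (c_fun \<tau>\<^sub>0 s ch z) (k_fun \<xi> z) (r, r') * (\<lambda>r\<in>Omega_bar a b. \<omega> * ?q r) r')"
    by (rule K_op_eq[OF _ r])
  also have "\<dots> = integral (Omega_bar a b)
      (\<lambda>r'. \<omega> * (exp_kernel (c_fun \<tau>\<^sub>0 s ch z) (k_fun \<xi> z) (r, r') * ?q r'))"
    by (rule integral_cong) simp
  also have "\<dots> = \<omega> * ?K ?q r" by (simp add: K_op_eq[OF q r])
  finally have KL: "?K (L_op a b \<xi> z ?q) r = \<omega> * ?K ?q r" by (simp add: L)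
  have "?K (L_op a b \<xi> z ?q) r - L_op a b \<xi> z (?K ?q) r = 0"
    using fun_cong[OF comm, of r] r by (simp add: zero_Y_def)
  then show ?thesis
    using \<open>\<omega> \<noteq> 0\<close> by (simp add: KL L_op_K_op_tensor[OF assms(1,2) f g r] field_simps)
qed

lemma C2_on_continuous:
  assumes "C2_on I f"
  shows "continuous_on I f"
  using assms unfolding C2_on_def continuous_on_eq_continuous_within
  by (blast intro: has_vector_derivative_continuous)

section \<open>Injectivity from unique expansions in the Lebesgue space\<close>

text \<open>
  The Cauchy-Schwarz inequality against the constant function, from
  \<open>0 \<le> \<integral> (V g - \<integral> g)\<^sup>2\<close> with \<open>V\<close> the volume of the box.
\<close>

lemma square_integral_le:
  fixes g :: "'a::euclidean_space \<Rightarrow> real"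
  assumes g: "continuous_on (cbox l u) g"
  shows "(integral (cbox l u) g)\<^sup>2 \<le> measure lborel (cbox l u) * integral (cbox l u) (\<lambda>r. (g r)\<^sup>2)"
proof -
  define V where "V = measure lborel (cbox l u)"
  define I where "I = integral (cbox l u) g"
  define J where "J = integral (cbox l u) (\<lambda>r. (g r)\<^sup>2)"
  have I: "(g has_integral I) (cbox l u)" unfolding I_def
    by (intro integrable_integral integrable_continuous g)
  have J: "((\<lambda>r. (g r)\<^sup>2) has_integral J) (cbox l u)" unfolding J_def
    by (intro integrable_integral integrable_continuous continuous_intros g)
  have "((\<lambda>r. V\<^sup>2 * (g r)\<^sup>2 - (2 * V * I) * g r + I\<^sup>2) has_integral
      V\<^sup>2 * J - (2 * V * I) * I + V *\<^sub>R I\<^sup>2) (cbox l u)"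
    unfolding V_def
    by (intro has_integral_add has_integral_diff has_integral_mult_right I J has_integral_const)
  moreover have "V\<^sup>2 * (g x)\<^sup>2 - (2 * V * I) * g x + I\<^sup>2 = (V * g x - I)\<^sup>2" for x
    by (simp add: power2_eq_square algebra_simps)
  ultimately have "((\<lambda>r. (V * g r - I)\<^sup>2) has_integral V\<^sup>2 * J - (2 * V * I) * I + V *\<^sub>R I\<^sup>2) (cbox l u)"
    by (simp only:)
  then have "0 \<le> V\<^sup>2 * J - (2 * V * I) * I + V *\<^sub>R I\<^sup>2"
    by (rule has_integral_nonneg) simp
  then have *: "0 \<le> V * (V * J - I\<^sup>2)" by (simp add: power2_eq_square algebra_simps)
  show ?thesis
  proof (cases "V = 0")
    case True
    then have "I = 0" using I has_integral_null[of l u g] has_integral_unique unfolding V_def by blast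
    then show ?thesis using True unfolding V_def I_def J_def by simp
  next
    case False
    then have "V > 0" using measure_nonneg[of lborel "cbox l u"] unfolding V_def by linarith
    then have "0 \<le> V * J - I\<^sup>2" using * by (simp add: zero_le_mult_iff)
    then show ?thesis unfolding V_def I_def J_def by simp
  qed
qed

text \<open>
  For a bounded kernel the value \<open>\<bar>(K w)(r)\<bar>\<close> is at most a multiple of \<open>\<integral> \<bar>w\<bar>\<close>, hence at most
  a multiple of the \<open>L\<^sup>2\<close> norm of \<open>w\<close>.
\<close>

lemma kernel_integral_L2_bound:
  fixes l u :: "'a::euclidean_space" and \<kappa> :: "'a \<times> 'a \<Rightarrow> complex"
  assumes \<kappa>: "continuous_on (cbox l u \<times> cbox l u) \<kappa>"
  shows "\<exists>C\<ge>0. \<forall>w. continuous_on (cbox l u) w \<longrightarrow>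
    integral (cbox l u) (\<lambda>r. (norm (\<mu> * w r - integral (cbox l u) (\<lambda>r'. \<kappa> (r, r') * w r')))\<^sup>2)
      \<le> C * integral (cbox l u) (\<lambda>r. (norm (w r))\<^sup>2)"
proof -
  define V where "V = measure lborel (cbox l u)"
  obtain B where B: "\<And>p. p \<in> cbox l u \<times> cbox l u \<Longrightarrow> norm (\<kappa> p) \<le> B"
    using compact_imp_bounded[OF compact_continuous_image[OF \<kappa> compact_Times[OF compact_cbox compact_cbox]]]
    by (auto simp: bounded_iff)
  define C where "C = 2 * (norm \<mu>)\<^sup>2 + 2 * B\<^sup>2 * V\<^sup>2"
  show ?thesis
  proof (intro exI[of _ C] conjI allI impI)
    show "C \<ge> 0" by (simp add: C_def)
    fix w :: "'a \<Rightarrow> complex" assume w: "continuous_on (cbox l u) w"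
    define N where "N = integral (cbox l u) (\<lambda>r. (norm (w r))\<^sup>2)"
    define T where "T r = integral (cbox l u) (\<lambda>r'. \<kappa> (r, r') * w r')" for r
    have T: "continuous_on (cbox l u) T"
      unfolding T_def by (rule continuous_on_kernel_integral[OF \<kappa> w])
    have Tb: "(norm (T r))\<^sup>2 \<le> B\<^sup>2 * (V * N)" if r: "r \<in> cbox l u" for r
    proof -
      have "norm (T r) \<le> integral (cbox l u) (\<lambda>r'. B * norm (w r'))"
        unfolding T_def
        by (rule Henstock_Kurzweil_Integration.integral_norm_bound_integral)
          (use r B in \<open>auto simp: norm_mult intro!: integrable_continuous continuous_intros w
            continuous_on_slice[OF \<kappa>] mult_right_mono\<close>)
      then have "norm (T r) \<le> B * integral (cbox l u) (\<lambda>r'. norm (w r'))" by simp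
      then have "(norm (T r))\<^sup>2 \<le> (B * integral (cbox l u) (\<lambda>r'. norm (w r')))\<^sup>2"
        by (intro power_mono) auto
      also have "\<dots> \<le> B\<^sup>2 * (V * N)"
        unfolding power_mult_distrib N_def V_def
        by (intro mult_left_mono square_integral_le continuous_intros w) auto
      finally show ?thesis .
    qed
    have "integral (cbox l u) (\<lambda>r. (norm (\<mu> * w r - T r))\<^sup>2) \<le>
        integral (cbox l u) (\<lambda>r. 2 * (norm \<mu>)\<^sup>2 * (norm (w r))\<^sup>2 + 2 * (B\<^sup>2 * (V * N)))"
    proof (rule integral_le)
      fix r assume r: "r \<in> cbox l u"
      have "(norm (\<mu> * w r - T r))\<^sup>2 \<le> (norm (\<mu> * w r) + norm (T r))\<^sup>2"
        by (intro power_mono norm_triangle_ineq4) auto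
      also have "\<dots> \<le> 2 * (norm (\<mu> * w r))\<^sup>2 + 2 * (norm (T r))\<^sup>2"
        using zero_le_power2[of "norm (\<mu> * w r) - norm (T r)"]
        by (simp add: power2_eq_square algebra_simps)
      also have "\<dots> \<le> 2 * (norm \<mu>)\<^sup>2 * (norm (w r))\<^sup>2 + 2 * (B\<^sup>2 * (V * N))"
        using Tb[OF r] by (simp add: norm_mult power_mult_distrib)
      finally show "(norm (\<mu> * w r - T r))\<^sup>2 \<le> 2 * (norm \<mu>)\<^sup>2 * (norm (w r))\<^sup>2 + 2 * (B\<^sup>2 * (V * N))" .
    qed (intro integrable_continuous continuous_intros w T)+
    also have "\<dots> = 2 * (norm \<mu>)\<^sup>2 * N + V * (2 * (B\<^sup>2 * (V * N)))"
    proof -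
      have "((\<lambda>r. (norm (w r))\<^sup>2) has_integral N) (cbox l u)" unfolding N_def
        by (intro integrable_integral integrable_continuous continuous_intros w)
      from has_integral_add[OF has_integral_mult_right[OF this, of "2 * (norm \<mu>)\<^sup>2"]
          has_integral_const[of "2 * (B\<^sup>2 * (V * N))" l u]]
      show ?thesis unfolding V_def by (simp add: integral_unique)
    qed
    also have "\<dots> = C * N" by (simp add: C_def power2_eq_square algebra_simps)
    finally show "integral (cbox l u) (\<lambda>r. (norm (\<mu> * w r - integral (cbox l u) (\<lambda>r'. \<kappa> (r, r') * w r')))\<^sup>2)
      \<le> C * integral (cbox l u) (\<lambda>r. (norm (w r))\<^sup>2)" by (simp add: T_def N_def)
  qed
qed

lemma L2_norm_on_Omega:
  assumes "continuous_on (Omega_bar a b) w"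
  shows "L2_norm_on (Omega a b) w = sqrt (integral (Omega_bar a b) (\<lambda>r. (norm (w r))\<^sup>2))"
  unfolding L2_norm_on_def by (subst integral_Omega) (auto intro!: continuous_intros assms)

lemma continuous_in_L2_on:
  assumes "continuous_on (Omega_bar a b) w"
  shows "w \<in> L2_on (Omega a b)"
proof -
  have "integrable (lebesgue_on (Omega a b)) (\<lambda>r. (norm (w r))\<^sup>2)"
    by (intro integrable_Omega continuous_intros assms)
  then show ?thesis
    using integrable_Omega[OF assms] by (simp add: L2_on_def)
qed

lemma L2_basis_expansion:
  assumes "L2_basis F S e" "f \<in> L2_on S"
  shows "\<exists>!x. ((\<lambda>B. L2_norm_on S (\<lambda>r. f r - (\<Sum>i\<in>B. x i * e i r))) \<longlongrightarrow> 0) F"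
  using assms(1) unfolding L2_basis_def by (elim conjE) (rule bspec[OF _ assms(2)])

text \<open>
  The zero function has the expansion with zero coefficients, and expansions are unique.
\<close>

lemma L2_basis_zero_expansion:
  assumes "L2_basis F S e"
    and "((\<lambda>B. L2_norm_on S (\<lambda>r. \<Sum>i\<in>B. x i * e i r)) \<longlongrightarrow> 0) F"
  shows "x i = 0"
proof -
  define P where "P x \<longleftrightarrow> ((\<lambda>B. L2_norm_on S (\<lambda>r. 0 - (\<Sum>i\<in>B. x i * e i r))) \<longlongrightarrow> 0) F" for x
  have "(\<lambda>r. 0) \<in> L2_on S" by (simp add: L2_on_def)
  from L2_basis_expansion[OF assms(1) this] have "\<exists>!x. P x" by (simp only: P_def)
  moreover have "P x" using assms(2) by (simp add: P_def L2_norm_on_def)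
  moreover have "P (\<lambda>i. 0)" by (simp add: P_def L2_norm_on_def)
  ultimately have "x = (\<lambda>i. 0)" by blast
  then show ?thesis by simp
qed

text \<open>
  Along the trivial filter every family of coefficients would represent zero.
\<close>

lemma L2_basis_nontrivial:
  assumes "L2_basis F S e"
  shows "F \<noteq> bot"
proof
  assume "F = bot"
  then show False using L2_basis_zero_expansion[OF assms, of "\<lambda>i. 1"] by simp
qed

lemma L2_basis_element_nonzero:
  assumes "L2_basis F S e"
  shows "\<exists>r\<in>S. e i r \<noteq> 0"
proof (rule ccontr)
  assume "\<not> ?thesis"
  then have 0: "e i r = 0" if "r \<in> S" for r using that by blast
  define x :: "'a \<Rightarrow> complex" where "x j = (if j = i then 1 else 0)" for j
  have "L2_norm_on S (\<lambda>r. \<Sum>j\<in>B. x j * e j r) = 0" for B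
  proof -
    have "(LINT r|lebesgue_on S. (norm (\<Sum>j\<in>B. x j * e j r))\<^sup>2) = (LINT r|lebesgue_on S. 0)"
      by (rule Bochner_Integration.integral_cong) (auto simp: x_def 0 intro!: sum.neutral)
    then show ?thesis by (simp add: L2_norm_on_def)
  qed
  then have "x i = 0" by (intro L2_basis_zero_expansion[OF assms]) simp
  then show False by (simp add: x_def)
qed

lemma continuous_eq_0_if_L2_null:
  fixes q :: "real \<times> real \<Rightarrow> complex"
  assumes "a > 0" "b > 0" "continuous_on (Omega_bar a b) q" "L2_norm_on (Omega a b) q = 0" "r \<in> Omega_bar a b"
  shows "q r = 0"
proof -
  have c: "continuous_on (cbox (-a, -b) (a, b)) (\<lambda>r. (norm (q r))\<^sup>2)"
    using assms(3) unfolding Omega_bar_cbox by (intro continuous_intros)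
  have "integral (cbox (-a, -b) (a, b)) (\<lambda>r. (norm (q r))\<^sup>2) = 0"
    using assms(4) L2_norm_on_Omega[OF assms(3)] by (simp add: Omega_bar_cbox)
  then have "((\<lambda>r. (norm (q r))\<^sup>2) has_integral 0) (cbox (-a, -b) (a, b))"
    using integrable_integral[OF integrable_continuous[OF c]] by simp
  moreover have "(0, 0) \<in> box (-a, -b) (a, b)"
    using assms(1,2) by (auto simp: mem_box Basis_prod_def)
  ultimately have "(norm (q r))\<^sup>2 = 0"
    using has_integral_0_cbox_imp_0[OF c, of r] assms(5) by (auto simp: Omega_bar_cbox)
  then show ?thesis by simp
qed

text \<open>
  Let \<open>w\<^sub>B\<close> be the error of the partial sum of the expansion of \<open>q\<close> over \<open>B\<close>.  Since \<open>\<mu> - K\<close> annihilates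
  \<open>q\<close> and multiplies \<open>e i\<close> by \<open>\<mu> - \<theta> i\<close>, it maps \<open>w\<^sub>B\<close> to
  \<open>- (\<Sum>i\<in>B. x i (\<mu> - \<theta> i) e i)\<close>.  By the \<open>L\<^sup>2\<close> bound these sums converge to zero, so
  \<open>x i (\<mu> - \<theta> i) = 0\<close> for all \<open>i\<close>.
\<close>

theorem injective_if_diagonal_on_L2_basis:
  fixes e :: "'i \<Rightarrow> real \<times> real \<Rightarrow> complex"
  assumes ab: "a > 0" "b > 0" and basis: "L2_basis F (Omega a b) e"
    and e: "\<And>i. continuous_on (Omega_bar a b) (e i)"
    and \<kappa>: "continuous_on (Omega_bar a b \<times> Omega_bar a b) \<kappa>"
    and eig: "\<And>i r. r \<in> Omega_bar a b \<Longrightarrow> integral (Omega_bar a b) (\<lambda>r'. \<kappa> (r, r') * e i r') = \<theta> i * e i r"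
    and ne: "\<And>i. \<mu> \<noteq> \<theta> i"
    and q: "continuous_on (Omega_bar a b) q"
    and fixed: "\<And>r. r \<in> Omega_bar a b \<Longrightarrow> \<mu> * q r = integral (Omega_bar a b) (\<lambda>r'. \<kappa> (r, r') * q r')"
    and r: "r \<in> Omega_bar a b"
  shows "q r = 0"
proof -
  let ?S = "Omega_bar a b" and ?N = "L2_norm_on (Omega a b)"
  from kernel_integral_L2_bound[OF \<kappa>[unfolded Omega_bar_cbox], folded Omega_bar_cbox, of \<mu>]
  obtain C where C: "C \<ge> 0" "\<forall>w. continuous_on ?S w \<longrightarrow>
    integral ?S (\<lambda>r. (norm (\<mu> * w r - integral ?S (\<lambda>r'. \<kappa> (r, r') * w r')))\<^sup>2)
      \<le> C * integral ?S (\<lambda>r. (norm (w r))\<^sup>2)" by (elim exE conjE)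
  from ex1_implies_ex[OF L2_basis_expansion[OF basis continuous_in_L2_on[OF q]]]
  obtain x where x: "((\<lambda>B. ?N (\<lambda>r. q r - (\<Sum>i\<in>B. x i * e i r))) \<longlongrightarrow> 0) F" ..
  define y where "y i = x i * (\<mu> - \<theta> i)" for i
  have bound: "?N (\<lambda>r. \<Sum>i\<in>B. y i * e i r) \<le> sqrt C * ?N (\<lambda>r. q r - (\<Sum>i\<in>B. x i * e i r))" for B
  proof -
    define w where "w r = q r - (\<Sum>i\<in>B. x i * e i r)" for r
    have w: "continuous_on ?S w" unfolding w_def by (intro continuous_intros q e)
    have ce: "continuous_on ?S (\<lambda>r. \<Sum>i\<in>B. y i * e i r)" by (intro continuous_intros e)
    have "\<mu> * w r - integral ?S (\<lambda>r'. \<kappa> (r, r') * w r') = - (\<Sum>i\<in>B. y i * e i r)" if r: "r \<in> ?S" for r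
    proof -
      have int: "(\<lambda>r'. \<kappa> (r, r') * h r') integrable_on ?S" if "continuous_on ?S h" for h
        unfolding Omega_bar_cbox
        by (intro integrable_continuous continuous_on_mult)
          (use continuous_on_slice[OF \<kappa> r] that in \<open>auto simp: Omega_bar_cbox\<close>)
      have summand: "integral ?S (\<lambda>r'. \<kappa> (r, r') * (x i * e i r')) = x i * (\<theta> i * e i r)" for i
      proof -
        have "integral ?S (\<lambda>r'. \<kappa> (r, r') * (x i * e i r')) = integral ?S (\<lambda>r'. x i * (\<kappa> (r, r') * e i r'))"
          by (rule integral_cong) (simp add: mult_ac)
        then show ?thesis by (simp add: eig[OF r])
      qed
      have "integral ?S (\<lambda>r'. \<kappa> (r, r') * w r') =
          integral ?S (\<lambda>r'. \<kappa> (r, r') * q r' - (\<Sum>i\<in>B. \<kappa> (r, r') * (x i * e i r')))"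
        by (rule integral_cong) (simp add: w_def right_diff_distrib sum_distrib_left)
      also have "\<dots> = integral ?S (\<lambda>r'. \<kappa> (r, r') * q r') -
          integral ?S (\<lambda>r'. \<Sum>i\<in>B. \<kappa> (r, r') * (x i * e i r'))"
      proof (rule integral_diff)
        show "(\<lambda>r'. \<kappa> (r, r') * q r') integrable_on ?S" by (rule int[OF q])
        have "continuous_on ?S (\<lambda>r'. \<Sum>i\<in>B. x i * e i r')" by (intro continuous_intros e)
        from int[OF this] show "(\<lambda>r'. \<Sum>i\<in>B. \<kappa> (r, r') * (x i * e i r')) integrable_on ?S"
          by (simp add: sum_distrib_left)
      qed
      also have "integral ?S (\<lambda>r'. \<Sum>i\<in>B. \<kappa> (r, r') * (x i * e i r')) = (\<Sum>i\<in>B. x i * (\<theta> i * e i r))"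
      proof (cases "finite B")
        case True
        then have "integral ?S (\<lambda>r'. \<Sum>i\<in>B. \<kappa> (r, r') * (x i * e i r')) =
            (\<Sum>i\<in>B. integral ?S (\<lambda>r'. \<kappa> (r, r') * (x i * e i r')))"
          by (rule integral_sum) (intro int continuous_intros e)
        then show ?thesis by (simp add: summand)
      qed simp
      finally have *: "integral ?S (\<lambda>r'. \<kappa> (r, r') * w r') = \<mu> * q r - (\<Sum>i\<in>B. x i * (\<theta> i * e i r))"
        by (simp only: fixed[OF r])
      show ?thesis unfolding *
        by (simp add: w_def y_def right_diff_distrib left_diff_distrib sum_distrib_left sum_subtractf mult_ac)
    qed
    then have "integral ?S (\<lambda>r. (norm (\<Sum>i\<in>B. y i * e i r))\<^sup>2) =
        integral ?S (\<lambda>r. (norm (\<mu> * w r - integral ?S (\<lambda>r'. \<kappa> (r, r') * w r')))\<^sup>2)"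
      by (intro integral_cong) simp
    also have "\<dots> \<le> C * integral ?S (\<lambda>r. (norm (w r))\<^sup>2)" by (rule C(2)[rule_format, OF w])
    finally have "?N (\<lambda>r. \<Sum>i\<in>B. y i * e i r) \<le> sqrt C * ?N w"
      unfolding L2_norm_on_Omega[OF ce] L2_norm_on_Omega[OF w] real_sqrt_mult[symmetric]
      by (rule real_sqrt_le_mono)
    then show ?thesis by (simp only: w_def[abs_def])
  qed
  have "y i = 0" for i
  proof (rule L2_basis_zero_expansion[OF basis])
    show "((\<lambda>B. ?N (\<lambda>r. \<Sum>i\<in>B. y i * e i r)) \<longlongrightarrow> 0) F"
    proof (rule Lim_null_comparison)
      show "((\<lambda>B. sqrt C * ?N (\<lambda>r. q r - (\<Sum>i\<in>B. x i * e i r))) \<longlongrightarrow> 0) F"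
        using tendsto_mult_right_zero[OF x] .
      show "\<forall>\<^sub>F B in F. norm (?N (\<lambda>r. \<Sum>i\<in>B. y i * e i r)) \<le> sqrt C * ?N (\<lambda>r. q r - (\<Sum>i\<in>B. x i * e i r))"
        using bound by (auto simp: L2_norm_on_def intro!: always_eventually)
    qed
  qed
  then have "x i = 0" for i using ne[of i] unfolding y_def by (metis mult_eq_0_iff right_minus_eq)
  then have "((\<lambda>B. ?N q) \<longlongrightarrow> 0) F" using x by simp
  then have "?N q = 0" using L2_basis_nontrivial[OF basis] by (simp add: tendsto_const_iff)
  then show ?thesis by (rule continuous_eq_0_if_L2_null[OF ab q _ r])
qed

section \<open>Variation of constants\<close>

text \<open>
  The function \<open>exp (- z t) (u(t) - v(t))\<close> has derivative zero.
\<close>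

lemma solution_linear_ode:
  fixes u v :: "real \<Rightarrow> complex"
  assumes "T \<ge> 0" and t: "t \<in> {-T..0}"
    and u: "\<And>t. t \<in> {-T..0} \<Longrightarrow> (u has_vector_derivative z * u t - f t) (at t within {-T..0})"
    and v: "\<And>t. t \<in> {-T..0} \<Longrightarrow> (v has_vector_derivative z * v t - f t) (at t within {-T..0})"
  shows "u t = exp (z * of_real t) * (u 0 - v 0) + v t"
proof -
  define w where "w t = exp (- z * of_real t) * (u t - v t)" for t
  have E: "((\<lambda>x. exp (- z * of_real x)) has_vector_derivative - z * exp (- z * of_real x)) (at x within S)" for x S
    by (rule has_vector_derivative_real_field) (auto intro!: derivative_eq_intros)
  have "(w has_vector_derivative 0) (at x within {-T..0})" if x: "x \<in> {-T..0}" for x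
  proof -
    have "(w has_vector_derivative exp (- z * of_real x) * ((z * u x - f x) - (z * v x - f x)) +
        - z * exp (- z * of_real x) * (u x - v x)) (at x within {-T..0})"
      unfolding w_def by (intro has_vector_derivative_mult has_vector_derivative_diff E u v x)
    then show ?thesis by (simp add: algebra_simps)
  qed
  then have "(w has_derivative (\<lambda>h. 0)) (at x within {-T..0})" if "x \<in> {-T..0}" for x
    using that by (simp add: has_vector_derivative_def)
  then obtain c where "\<And>x. x \<in> {-T..0} \<Longrightarrow> w x = c"
    using has_derivative_zero_constant[of "{-T..0}" w] by (auto simp: convex_real_interval)
  then have "w t = w 0" using t \<open>T \<ge> 0\<close> by simp
  then have "exp (z * of_real t) * w t = exp (z * of_real t) * (u 0 - v 0)" by (simp add: w_def)
  moreover have "exp (z * of_real t) * w t = u t - v t"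
    by (simp add: w_def mult.assoc[symmetric] flip: exp_add)
  ultimately have "u t - v t = exp (z * of_real t) * (u 0 - v 0)" by (simp only:)
  then show ?thesis by (simp add: diff_eq_eq)
qed

text \<open>
  The solution of \<open>u' = z u - f\<close> on the negative half-line with \<open>u(0) = 0\<close>.
\<close>

definition past_integral :: "complex \<Rightarrow> (real \<Rightarrow> complex) \<Rightarrow> real \<Rightarrow> complex" where
  "past_integral z f t = integral {t..0} (\<lambda>s. exp (z * of_real (t - s)) * f s)"

lemma past_integral_0 [simp]: "past_integral z f 0 = 0"
  by (simp add: past_integral_def)

lemma past_integral_deriv:
  assumes f: "continuous_on {-T..0} f" and t: "t \<in> {-T..0}"
  shows "(past_integral z f has_vector_derivative z * past_integral z f t - f t) (at t within {-T..0})"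
proof -
  define g where "g s = exp (- z * of_real s) * f s" for s
  have g: "continuous_on {-T..0} g" unfolding g_def by (intro continuous_intros f)
  have eq: "past_integral z f x = exp (z * of_real x) * (integral {-T..0} g - integral {-T..x} g)"
    if x: "x \<in> {-T..0}" for x
  proof -
    have "past_integral z f x = integral {x..0} (\<lambda>s. exp (z * of_real x) * g s)"
      unfolding past_integral_def
      by (rule integral_cong) (simp add: g_def algebra_simps flip: exp_add)
    also have "\<dots> = exp (z * of_real x) * integral {x..0} g" by simp
    also have "integral {-T..x} g + integral {x..0} g = integral {-T..0} g"
      by (rule Henstock_Kurzweil_Integration.integral_combine)
        (use x g in \<open>auto intro: integrable_continuous_interval\<close>)
    then have "integral {x..0} g = integral {-T..0} g - integral {-T..x} g" by (simp add: eq_diff_eq add.commute)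
    finally show ?thesis .
  qed
  have E: "((\<lambda>x. exp (z * of_real x)) has_vector_derivative z * exp (z * of_real t)) (at t within S)" for S
    by (rule has_vector_derivative_real_field) (auto intro!: derivative_eq_intros)
  have "((\<lambda>x. exp (z * of_real x) * (integral {-T..0} g - integral {-T..x} g)) has_vector_derivative
      exp (z * of_real t) * (0 - g t) + z * exp (z * of_real t) * (integral {-T..0} g - integral {-T..t} g))
      (at t within {-T..0})"
    by (intro has_vector_derivative_mult has_vector_derivative_diff E has_vector_derivative_const
        integral_has_vector_derivative g t)
  also have "exp (z * of_real t) * (0 - g t) = - f t"
    by (simp add: g_def mult.assoc[symmetric] flip: exp_add)
  also have "- f t + z * exp (z * of_real t) * (integral {-T..0} g - integral {-T..t} g) =
      z * past_integral z f t - f t"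
    by (simp only: eq[OF t]) simp
  finally show ?thesis by (rule has_vector_derivative_transform[OF t eq, rotated])
qed

lemma past_integral_bound:
  assumes f: "continuous_on {-T..0} f" and t: "t \<in> {-T..0}"
    and C: "\<And>s. s \<in> {-T..0} \<Longrightarrow> norm (f s) \<le> C"
  shows "norm (past_integral z f t) \<le> exp (norm z * T) * T * C"
proof -
  have C0: "0 \<le> C" using C[OF t] norm_ge_zero order_trans by blast
  have "norm (past_integral z f t) \<le> (exp (norm z * T) * C) * (0 - t)"
    unfolding past_integral_def
  proof (rule integral_bound)
    show "t \<le> 0" using t by simp
    show "continuous_on {t..0} (\<lambda>s. exp (z * of_real (t - s)) * f s)"
      by (intro continuous_intros continuous_on_subset[OF f]) (use t in auto)
    fix s assume s: "s \<in> {t..0}"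
    have "norm (exp (z * of_real (t - s))) \<le> exp (norm (z * of_real (t - s)))" by (rule norm_exp)
    also have "\<dots> \<le> exp (norm z * T)"
      using s t by (auto simp: norm_mult simp del: of_real_diff intro!: mult_left_mono)
    finally show "norm (exp (z * of_real (t - s)) * f s) \<le> exp (norm z * T) * C"
      unfolding norm_mult using C[of s] s t by (intro mult_mono) auto
  qed
  also have "\<dots> \<le> (exp (norm z * T) * C) * T" using t C0 by (intro mult_left_mono) auto
  finally show ?thesis by (simp add: mult_ac)
qed

lemma continuous_on_past_integral:
  fixes f :: "real \<Rightarrow> 'a::topological_space \<Rightarrow> complex"
  assumes f: "continuous_on ({-T..0} \<times> D) (\<lambda>p. f (fst p) (snd p))"
  shows "continuous_on ({-T..0} \<times> D) (\<lambda>p. past_integral z (\<lambda>s. f s (snd p)) (fst p))"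
proof -
  \<comment> \<open>Continuing the integrand from \<open>[t, 0]\<close> to all of \<open>[-T, 0]\<close> by its value \<open>f t r\<close> at \<open>s = t\<close>
    makes the domain of integration independent of \<open>t\<close>.\<close>
  define g where "g t r s = exp (z * of_real (t - max s t)) * f (max s t) r" for t r s
  have g: "continuous_on (({-T..0} \<times> D) \<times> cbox (-T) 0) (\<lambda>q. g (fst (fst q)) (snd (fst q)) (snd q))"
    unfolding g_def
    by (intro continuous_intros continuous_on_compose2[OF f, of _ "\<lambda>q. (max (snd q) (fst (fst q)), snd (fst q))", unfolded fst_conv snd_conv])
       auto
  have 1: "continuous_on ({-T..0} \<times> D) (\<lambda>p. integral (cbox (-T) 0) (g (fst p) (snd p)))"
    using integral_continuous_on_param[of "{-T..0} \<times> D" "-T" 0 "\<lambda>p. g (fst p) (snd p)"] g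
    by (simp add: case_prod_unfold)
  have "past_integral z (\<lambda>s. f s r) t = integral (cbox (-T) 0) (g t r) - of_real (t + T) * f t r"
    if t: "t \<in> {-T..0}" and r: "r \<in> D" for t r
  proof -
    have "continuous_on {-T..0} (g t r)"
    proof -
      have "(\<lambda>s. ((t, r), s)) ` {-T..0} \<subseteq> ({-T..0} \<times> D) \<times> cbox (-T) 0" using t r by auto
      from continuous_on_compose2[OF g _ this] show ?thesis by (simp add: continuous_on_Pair)
    qed
    then have "integral {-T..t} (g t r) + integral {t..0} (g t r) = integral {-T..0} (g t r)"
      by (intro Henstock_Kurzweil_Integration.integral_combine)
        (use t in \<open>auto intro: integrable_continuous_interval\<close>)
    moreover have "integral {-T..t} (g t r) = integral {-T..t} (\<lambda>s. f t r)"
      by (rule integral_cong) (auto simp: g_def max_def)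
    moreover have "integral {t..0} (g t r) = past_integral z (\<lambda>s. f s r) t"
      unfolding past_integral_def by (rule integral_cong) (auto simp: g_def max_def)
    ultimately show ?thesis using t by (simp add: scaleR_conv_of_real algebra_simps)
  qed
  note eq = this
  have "continuous_on ({-T..0} \<times> D)
      (\<lambda>p. integral (cbox (-T) 0) (g (fst p) (snd p)) - of_real (fst p + T) * f (fst p) (snd p))"
    by (intro continuous_on_diff 1 continuous_on_mult f continuous_intros)
  then show ?thesis by (rule continuous_on_eq) (auto simp: eq)
qed

section \<open>The history space as a space of jointly continuous functions\<close>

text \<open>
  The remainder form of differentiability.  Asking for it uniformly in a parameter gives
  differentiability in the supremum norm.
\<close>

lemma has_vector_derivative_within_eventually:
  "(f has_vector_derivative d) (at x within S) \<longleftrightarrow>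
    (\<forall>e>0. \<forall>\<^sub>F y in at x within S. norm (f y - f x - (y - x) *\<^sub>R d) \<le> e * \<bar>y - x\<bar>)"
  by (simp add: has_vector_derivative_def has_derivative_within_alt2 bounded_linear_scaleR_left)

lemma norm_difference_quotient:
  fixes w d :: complex and h :: real
  assumes "h \<noteq> 0"
  shows "norm (w - h *\<^sub>R d) = norm (w / of_real h - d) * \<bar>h\<bar>"
proof -
  have "w - h *\<^sub>R d = (w / of_real h - d) * of_real h"
    using assms by (simp add: field_simps scaleR_conv_of_real)
  then show ?thesis by (simp only: norm_mult norm_of_real)
qed

text \<open>
  Continuity in \<open>t\<close> of the slices \<open>g(t, _)\<close> for the supremum norm, with a modulus that is uniform in
  \<open>t\<close>; this is what relates joint continuity to curves in \<open>C(D)\<close>.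
\<close>

lemma uniformly_close_slices:
  fixes g :: "'a::metric_space \<times> 'b::metric_space \<Rightarrow> 'c::metric_space"
  assumes "compact H" "compact D" "continuous_on (H \<times> D) g" "e > 0"
  obtains d where "d > 0"
    "\<And>t u r. t \<in> H \<Longrightarrow> u \<in> H \<Longrightarrow> r \<in> D \<Longrightarrow> dist u t < d \<Longrightarrow> dist (g (u, r)) (g (t, r)) < e"
proof -
  have "uniformly_continuous_on (H \<times> D) g"
    by (rule compact_uniformly_continuous[OF assms(3) compact_Times[OF assms(1,2)]])
  then obtain d where d: "d > 0"
    "\<And>p p'. p \<in> H \<times> D \<Longrightarrow> p' \<in> H \<times> D \<Longrightarrow> dist p' p < d \<Longrightarrow> dist (g p') (g p) < e"
    using assms(4) unfolding uniformly_continuous_on_def by metis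
  show ?thesis
    by (rule that[OF d(1)]) (rule d(2), auto simp: dist_Pair_Pair)
qed

lemma atin_within_euclidean: "atin_within euclidean a S = at a within S"
  by (rule filter_eq_iff[THEN iffD2]) (auto simp: eventually_atin_within eventually_at_topological)

lemma compact_Omega_bar: "compact (Omega_bar a b)"
  by (simp add: Omega_bar_cbox)

lemma mspace_Y_iff: "q \<in> mspace (Y_space a b) \<longleftrightarrow>
    q \<in> extensional (Omega_bar a b) \<and> continuous_on (Omega_bar a b) q"
  unfolding Y_space_def
  by (subst compactin_mspace_cfunspace) (auto simp: compactin_subtopology compact_Omega_bar)

lemma compact_hist: "compact (hist_interval a b \<tau>\<^sub>0)"
  by (simp add: hist_interval_def)

locale delayed_rectangle =
  fixes a b \<tau>\<^sub>0 :: real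
  assumes a: "a > 0" and b: "b > 0" and \<tau>\<^sub>0: "\<tau>\<^sub>0 > 0"
begin

abbreviation (input) D where "D \<equiv> Omega_bar a b"
abbreviation (input) H where "H \<equiv> hist_interval a b \<tau>\<^sub>0"

lemma origin_in: "(0, 0) \<in> D" using a b by (simp add: Omega_bar_def)

lemma zero_in_hist: "0 \<in> H" using a b \<tau>\<^sub>0 by (simp add: hist_interval_def)

lemma mdist_Y_le:
  assumes "q \<in> mspace (Y_space a b)" "q' \<in> mspace (Y_space a b)"
  shows "mdist (Y_space a b) q q' \<le> e \<longleftrightarrow> (\<forall>r\<in>D. norm (q r - q' r) \<le> e)"
  using assms origin_in unfolding Y_space_def
  by (subst cfunspace_mdist_le) (auto simp: dist_norm)

lemma limitin_Y_iff:
  "limitin (mtopology_of (Y_space a b)) f q G \<longleftrightarrow> q \<in> mspace (Y_space a b) \<and>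
    (\<forall>\<^sub>F u in G. f u \<in> mspace (Y_space a b)) \<and>
    (\<forall>e>0. \<forall>\<^sub>F u in G. \<forall>r\<in>D. norm (f u r - q r) \<le> e)" (is "_ \<longleftrightarrow> ?Y q \<and> ?E \<and> ?C")
proof -
  have "limitin (mtopology_of (Y_space a b)) f q G \<longleftrightarrow> ?Y q \<and>
      (\<forall>e>0. \<forall>\<^sub>F u in G. ?Y (f u) \<and> mdist (Y_space a b) (f u) q < e)"
    unfolding mtopology_of_def
    by (rule Metric_space.limitin_metric[OF Metric_space_mspace_mdist])
  also have "\<dots> \<longleftrightarrow> ?Y q \<and> ?E \<and> ?C"
  proof (intro conj_cong refl iffI conjI allI impI)
    assume q: "?Y q" and *: "\<forall>e>0. \<forall>\<^sub>F u in G. ?Y (f u) \<and> mdist (Y_space a b) (f u) q < e"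
    show ?E using *[rule_format, of 1] by (auto elim: eventually_mono)
    show "\<forall>\<^sub>F u in G. \<forall>r\<in>D. norm (f u r - q r) \<le> e" if "e > 0" for e
      using *[rule_format, OF that] by eventually_elim (use q mdist_Y_le in \<open>auto dest: less_imp_le\<close>)
  next
    fix e :: real
    assume q: "?Y q" and *: "?E \<and> ?C" and "e > 0"
    then have "\<forall>\<^sub>F u in G. \<forall>r\<in>D. norm (f u r - q r) \<le> e / 2"
      using conjunct2[OF *, rule_format, of "e / 2"] by linarith
    with conjunct1[OF *] show "\<forall>\<^sub>F u in G. ?Y (f u) \<and> mdist (Y_space a b) (f u) q < e"
    proof eventually_elim
      case (elim u)
      then have "mdist (Y_space a b) (f u) q \<le> e / 2" using mdist_Y_le[OF elim(1) q, of "e / 2"] by blast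
      with elim \<open>e > 0\<close> show ?case by simp
    qed
  qed
  finally show ?thesis .
qed

text \<open>
  A continuous curve in \<open>C(D)\<close> is the same as a jointly continuous function on \<open>H \<times> D\<close>, so that elements
  of the history space can be handled pointwise.
\<close>

lemma mspace_X_iff:
  "\<phi> \<in> mspace (X_space a b \<tau>\<^sub>0) \<longleftrightarrow> \<phi> \<in> extensional H \<and> (\<forall>t\<in>H. \<phi> t \<in> extensional D) \<and>
    continuous_on (H \<times> D) (\<lambda>p. \<phi> (fst p) (snd p))"
proof -
  have "\<phi> \<in> mspace (X_space a b \<tau>\<^sub>0) \<longleftrightarrow> \<phi> \<in> extensional H \<and> (\<forall>t\<in>H. \<phi> t \<in> mspace (Y_space a b)) \<and>
      (\<forall>t\<in>H. limitin (mtopology_of (Y_space a b)) \<phi> (\<phi> t) (at t within H))"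
    unfolding X_space_def
    by (subst compactin_mspace_cfunspace)
       (auto simp: compactin_subtopology compact_hist continuous_map_atin atin_subtopology_within atin_within_euclidean)
  also have "\<dots> \<longleftrightarrow> \<phi> \<in> extensional H \<and> (\<forall>t\<in>H. \<phi> t \<in> mspace (Y_space a b)) \<and>
      (\<forall>t\<in>H. \<forall>e>0. \<forall>\<^sub>F u in at t within H. \<forall>r\<in>D. norm (\<phi> u r - \<phi> t r) \<le> e)"
    by (auto simp: limitin_Y_iff eventually_at_filter)
  also have "\<dots> \<longleftrightarrow> \<phi> \<in> extensional H \<and> (\<forall>t\<in>H. \<phi> t \<in> extensional D) \<and>
    continuous_on (H \<times> D) (\<lambda>p. \<phi> (fst p) (snd p))" (is "?L \<longleftrightarrow> ?R")
  proof
    assume L: ?L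
    have "continuous_on (H \<times> D) (\<lambda>p. \<phi> (fst p) (snd p))"
      unfolding continuous_on_iff
    proof (intro ballI allI impI)
      fix p :: "real \<times> real \<times> real" and e :: real assume p: "p \<in> H \<times> D" and e: "e > 0"
      obtain t r where tr: "p = (t, r)" "t \<in> H" "r \<in> D" using p by auto
      have "e/3 > 0" using e by simp
      with L tr(2) have "\<forall>\<^sub>F u in at t within H. \<forall>r\<in>D. norm (\<phi> u r - \<phi> t r) \<le> e/3" by blast
      then obtain d where d1: "d > 0"
        "\<forall>u\<in>H. u \<noteq> t \<and> dist u t < d \<longrightarrow> (\<forall>r\<in>D. norm (\<phi> u r - \<phi> t r) \<le> e/3)"
        unfolding eventually_at by blast
      have d: "d > 0" "\<And>u r. u \<in> H \<Longrightarrow> dist u t < d \<Longrightarrow> r \<in> D \<Longrightarrow> norm (\<phi> u r - \<phi> t r) \<le> e/3"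
        using d1 \<open>e/3 > 0\<close> by (force, case_tac "u = t") auto
      have "continuous_on D (\<phi> t)" using L tr(2) by (simp add: mspace_Y_iff)
      then obtain d' where d': "d' > 0" "\<And>r'. r' \<in> D \<Longrightarrow> dist r' r < d' \<Longrightarrow> dist (\<phi> t r') (\<phi> t r) < e/3"
        using \<open>e/3 > 0\<close> tr(3) unfolding continuous_on_iff by blast
      show "\<exists>d>0. \<forall>x'\<in>H \<times> D. dist x' p < d \<longrightarrow> dist (\<phi> (fst x') (snd x')) (\<phi> (fst p) (snd p)) < e"
      proof (intro exI[of _ "min d d'"] conjI ballI impI)
        fix x' assume x': "x' \<in> H \<times> D" "dist x' p < min d d'"
        have 1: "dist (fst x') t < d" "dist (snd x') r < d'"
          using x'(2) dist_fst_le[of x' p] dist_snd_le[of x' p] tr(1) by auto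
        have "dist (\<phi> (fst x') (snd x')) (\<phi> t r) \<le>
            dist (\<phi> (fst x') (snd x')) (\<phi> t (snd x')) + dist (\<phi> t (snd x')) (\<phi> t r)"
          by (rule dist_triangle)
        moreover have "dist (\<phi> (fst x') (snd x')) (\<phi> t (snd x')) \<le> e/3"
          using d(2)[of "fst x'" "snd x'"] 1 x'(1) by (auto simp: dist_norm)
        moreover have "dist (\<phi> t (snd x')) (\<phi> t r) < e/3" using d'(2)[of "snd x'"] 1 x'(1) by auto
        ultimately show "dist (\<phi> (fst x') (snd x')) (\<phi> (fst p) (snd p)) < e" using e tr(1) by simp
      qed (use d(1) d'(1) in auto)
    qed
    with L show ?R by (simp add: mspace_Y_iff)
  next
    assume R: ?R
    have "\<phi> t \<in> mspace (Y_space a b)" if "t \<in> H" for t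
      using R that continuous_on_slice[of H D "\<lambda>p. \<phi> (fst p) (snd p)" t] by (simp add: mspace_Y_iff)
    moreover have "\<forall>\<^sub>F u in at t within H. \<forall>r\<in>D. norm (\<phi> u r - \<phi> t r) \<le> e" if t: "t \<in> H" and e: "e > 0" for t e
    proof -
      obtain d where "d > 0" "\<And>t u r. t \<in> H \<Longrightarrow> u \<in> H \<Longrightarrow> r \<in> D \<Longrightarrow> dist u t < d \<Longrightarrow> dist (\<phi> u r) (\<phi> t r) < e"
        using uniformly_close_slices[OF compact_hist compact_Omega_bar conjunct2[OF conjunct2[OF R]] e] by auto
      then show ?thesis using t unfolding eventually_at by (auto simp: dist_norm intro!: exI[of _ d] less_imp_le)
    qed
    ultimately show ?L using R by simp
  qed
  finally show ?thesis .
qed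

text \<open>
  If \<open>\<psi>\<close> is jointly continuous, a pointwise derivative in \<open>t\<close> is already a derivative in the supremum
  norm: by the mean value inequality the remainder at \<open>r\<close> is at most \<open>\<bar>u - t\<bar>\<close> times the oscillation of
  \<open>\<psi>(_, r)\<close> between \<open>t\<close> and \<open>u\<close>, which is small uniformly in \<open>r\<close>.
\<close>

lemma has_X_derivative_iff:
  assumes \<phi>: "\<phi> \<in> mspace (X_space a b \<tau>\<^sub>0)" and \<psi>: "\<psi> \<in> mspace (X_space a b \<tau>\<^sub>0)"
  shows "has_X_derivative a b \<tau>\<^sub>0 \<phi> \<psi> \<longleftrightarrow>
    (\<forall>t\<in>H. \<forall>r\<in>D. ((\<lambda>u. \<phi> u r) has_vector_derivative \<psi> t r) (at t within H))"
proof -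
  let ?Q = "\<lambda>t u. \<lambda>r\<in>D. (\<phi> u r - \<phi> t r) / of_real (u - t)"
  have contX: "continuous_on D (f t)" if "f \<in> mspace (X_space a b \<tau>\<^sub>0)" "t \<in> H" for f t
    using that continuous_on_slice[of H D "\<lambda>p. f (fst p) (snd p)" t] by (simp add: mspace_X_iff)
  have Y: "\<psi> t \<in> mspace (Y_space a b)" if "t \<in> H" for t
    using \<psi> contX[OF \<psi> that] that by (simp add: mspace_Y_iff mspace_X_iff)
  have QY: "?Q t u \<in> mspace (Y_space a b)" if "t \<in> H" "u \<in> H" "u \<noteq> t" for t u
  proof -
    have "continuous_on D (\<lambda>r. (\<phi> u r - \<phi> t r) / of_real (u - t))"
      by (intro continuous_intros contX[OF \<phi>] that) (use that in auto)
    then show ?thesis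
      by (simp add: mspace_Y_iff cong: continuous_on_cong)
  qed
  have ev: "\<forall>\<^sub>F u in at t within H. u \<in> H \<and> u \<noteq> t" for t
    by (simp add: eventually_at_filter)
  have lim: "limitin (mtopology_of (Y_space a b)) (?Q t) (\<psi> t) (at t within H) \<longleftrightarrow>
      (\<forall>e>0. \<forall>\<^sub>F u in at t within H. \<forall>r\<in>D. norm (\<phi> u r - \<phi> t r - (u - t) *\<^sub>R \<psi> t r) \<le> e * \<bar>u - t\<bar>)"
    if t: "t \<in> H" for t
  proof -
    have "\<forall>\<^sub>F u in at t within H. ?Q t u \<in> mspace (Y_space a b)"
      using ev[of t] by eventually_elim (use QY t in auto)
    moreover have "(\<forall>\<^sub>F u in at t within H. \<forall>r\<in>D. norm (?Q t u r - \<psi> t r) \<le> e) \<longleftrightarrow>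
       (\<forall>\<^sub>F u in at t within H. \<forall>r\<in>D. norm (\<phi> u r - \<phi> t r - (u - t) *\<^sub>R \<psi> t r) \<le> e * \<bar>u - t\<bar>)" for e
    proof (rule eventually_cong[OF ev[of t]])
      fix u assume u: "u \<in> H \<and> u \<noteq> t"
      then have "norm (\<phi> u r - \<phi> t r - (u - t) *\<^sub>R \<psi> t r) =
          norm ((\<phi> u r - \<phi> t r) / of_real (u - t) - \<psi> t r) * \<bar>u - t\<bar>" for r
        by (intro norm_difference_quotient) simp
      then show "(\<forall>r\<in>D. norm (?Q t u r - \<psi> t r) \<le> e) \<longleftrightarrow>
          (\<forall>r\<in>D. norm (\<phi> u r - \<phi> t r - (u - t) *\<^sub>R \<psi> t r) \<le> e * \<bar>u - t\<bar>)"
        using u by (simp del: of_real_diff)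
    qed
    ultimately show ?thesis by (simp add: limitin_Y_iff Y[OF t])
  qed
  show ?thesis
  proof
    assume X: "has_X_derivative a b \<tau>\<^sub>0 \<phi> \<psi>"
    show "\<forall>t\<in>H. \<forall>r\<in>D. ((\<lambda>u. \<phi> u r) has_vector_derivative \<psi> t r) (at t within H)"
    proof (intro ballI)
      fix t r assume t: "t \<in> H" and r: "r \<in> D"
      have *: "\<forall>e>0. \<forall>\<^sub>F u in at t within H. \<forall>r\<in>D. norm (\<phi> u r - \<phi> t r - (u - t) *\<^sub>R \<psi> t r) \<le> e * \<bar>u - t\<bar>"
        using X t lim[OF t] unfolding has_X_derivative_def by blast
      show "((\<lambda>u. \<phi> u r) has_vector_derivative \<psi> t r) (at t within H)"
        unfolding has_vector_derivative_within_eventually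
      proof (intro allI impI)
        fix e :: real assume "e > 0"
        with * have "\<forall>\<^sub>F u in at t within H. \<forall>r\<in>D. norm (\<phi> u r - \<phi> t r - (u - t) *\<^sub>R \<psi> t r) \<le> e * \<bar>u - t\<bar>" by blast
        then show "\<forall>\<^sub>F u in at t within H. norm (\<phi> u r - \<phi> t r - (u - t) *\<^sub>R \<psi> t r) \<le> e * \<bar>u - t\<bar>"
          by eventually_elim (use r in blast)
      qed
    qed
  next
    assume P: "\<forall>t\<in>H. \<forall>r\<in>D. ((\<lambda>u. \<phi> u r) has_vector_derivative \<psi> t r) (at t within H)"
    show "has_X_derivative a b \<tau>\<^sub>0 \<phi> \<psi>"
      unfolding has_X_derivative_def
    proof (intro ballI)
      fix t assume t: "t \<in> H"
      have "\<forall>\<^sub>F u in at t within H. \<forall>r\<in>D. norm (\<phi> u r - \<phi> t r - (u - t) *\<^sub>R \<psi> t r) \<le> e * \<bar>u - t\<bar>"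
        if e: "e > 0" for e
      proof -
        have "continuous_on (H \<times> D) (\<lambda>p. \<psi> (fst p) (snd p))" using \<psi> by (simp add: mspace_X_iff)
        from uniformly_close_slices[OF compact_hist compact_Omega_bar this e]
        obtain d where d: "d > 0" "\<And>t u r. t \<in> H \<Longrightarrow> u \<in> H \<Longrightarrow> r \<in> D \<Longrightarrow> dist u t < d \<Longrightarrow> dist (\<psi> u r) (\<psi> t r) < e"
          by auto
        have "norm (\<phi> u r - \<phi> t r - (u - t) *\<^sub>R \<psi> t r) \<le> e * \<bar>u - t\<bar>"
          if u: "u \<in> H" "dist u t < d" and r: "r \<in> D" for u r
        proof -
          have seg: "closed_segment t u \<subseteq> H"
            using t u(1) by (intro closed_segment_subset) (auto simp: hist_interval_def)
          have "norm (\<phi> u r - \<phi> t r - (u - t) *\<^sub>R \<psi> t r) \<le> norm (u - t) * e"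
          proof (rule vector_differentiable_bound_linearization[where S="closed_segment t u" and f'="\<lambda>x. \<psi> x r"])
            fix x assume x: "x \<in> closed_segment t u"
            then have xH: "x \<in> H" using seg by blast
            show "((\<lambda>u. \<phi> u r) has_vector_derivative \<psi> x r) (at x within closed_segment t u)"
              using P xH r seg has_vector_derivative_within_subset by blast
            have "dist x t < d" using x u(2) by (auto simp: closed_segment_eq_real_ivl dist_real_def split: if_splits)
            then show "norm (\<psi> x r - \<psi> t r) \<le> e"
              using d(2)[OF t xH r] by (simp add: dist_norm)
          qed auto
          then show ?thesis by (simp add: mult.commute)
        qed
        then show ?thesis using d(1) unfolding eventually_at by blast
      qed
      then show "limitin (mtopology_of (Y_space a b)) (?Q t) (\<psi> t) (at t within H)"
        unfolding lim[OF t] by blast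
    qed
  qed
qed

lemma X_continuous:
  assumes "\<phi> \<in> mspace (X_space a b \<tau>\<^sub>0)"
  shows "continuous_on (H \<times> D) (\<lambda>p. \<phi> (fst p) (snd p))"
  using assms by (simp add: mspace_X_iff)

lemma X_continuous_slices:
  assumes "\<phi> \<in> mspace (X_space a b \<tau>\<^sub>0)"
  shows "t \<in> H \<Longrightarrow> continuous_on D (\<phi> t)" and "r \<in> D \<Longrightarrow> continuous_on H (\<lambda>t. \<phi> t r)"
proof -
  show "continuous_on D (\<phi> t)" if "t \<in> H"
    using continuous_on_slice[OF X_continuous[OF assms] that] by simp
  show "continuous_on H (\<lambda>t. \<phi> t r)" if "r \<in> D"
  proof -
    have "continuous_on H (\<lambda>t. (t, r))" by (intro continuous_intros)
    moreover have "(\<lambda>t. (t, r)) ` H \<subseteq> H \<times> D" using that by auto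
    ultimately show ?thesis
      using continuous_on_compose2[OF X_continuous[OF assms], of H "\<lambda>t. (t, r)"] by simp
  qed
qed

lemma restrict_in_X:
  assumes "continuous_on (H \<times> D) (\<lambda>p. h (fst p) (snd p))"
  shows "(\<lambda>t\<in>H. \<lambda>r\<in>D. h t r) \<in> mspace (X_space a b \<tau>\<^sub>0)"
proof -
  have "continuous_on (H \<times> D) (\<lambda>p. (\<lambda>t\<in>H. \<lambda>r\<in>D. h t r) (fst p) (snd p))"
    by (rule continuous_on_eq[OF assms]) auto
  then show ?thesis by (simp add: mspace_X_iff)
qed

lemma X_eqI:
  assumes "\<phi> \<in> mspace (X_space a b \<tau>\<^sub>0)" "\<psi> \<in> mspace (X_space a b \<tau>\<^sub>0)"
    and "\<And>t r. t \<in> H \<Longrightarrow> r \<in> D \<Longrightarrow> \<phi> t r = \<psi> t r"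
  shows "\<phi> = \<psi>"
  using assms unfolding mspace_X_iff by (intro extensionalityI[of _ H] extensionalityI[of _ D]) auto

lemma zero_X_in: "zero_X a b \<tau>\<^sub>0 \<in> mspace (X_space a b \<tau>\<^sub>0)"
  unfolding zero_X_def zero_Y_def by (rule restrict_in_X) (rule continuous_on_const)

lemma norm_X_le_iff:
  assumes "\<phi> \<in> mspace (X_space a b \<tau>\<^sub>0)"
  shows "norm_X a b \<tau>\<^sub>0 \<phi> \<le> C \<longleftrightarrow> (\<forall>t\<in>H. \<forall>r\<in>D. norm (\<phi> t r) \<le> C)"
proof -
  have Y: "f t \<in> mspace (Y_space a b)" if "f \<in> mspace (X_space a b \<tau>\<^sub>0)" "t \<in> H" for f t
    using X_continuous_slices(1)[OF that] that by (simp add: mspace_Y_iff mspace_X_iff)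
  have "norm_X a b \<tau>\<^sub>0 \<phi> \<le> C \<longleftrightarrow> (\<forall>t\<in>H. mdist (Y_space a b) (\<phi> t) (zero_X a b \<tau>\<^sub>0 t) \<le> C)"
    using cfunspace_mdist_le[OF assms[unfolded X_space_def] zero_X_in[unfolded X_space_def]] zero_in_hist
    unfolding norm_X_def X_space_def by auto
  also have "\<dots> \<longleftrightarrow> (\<forall>t\<in>H. \<forall>r\<in>D. norm (\<phi> t r) \<le> C)"
    by (intro ball_cong refl)
       (subst mdist_Y_le[OF Y[OF assms] Y[OF zero_X_in]], auto simp: zero_X_def zero_Y_def)
  finally show ?thesis .
qed

lemma A_op_eqI:
  assumes "\<phi> \<in> mspace (X_space a b \<tau>\<^sub>0)" "\<psi> \<in> mspace (X_space a b \<tau>\<^sub>0)" "has_X_derivative a b \<tau>\<^sub>0 \<phi> \<psi>"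
  shows "A_op a b \<tau>\<^sub>0 \<phi> = \<psi>"
  unfolding A_op_def
proof (rule the_equality)
  show "\<psi> \<in> mspace (X_space a b \<tau>\<^sub>0) \<and> has_X_derivative a b \<tau>\<^sub>0 \<phi> \<psi>" using assms by simp
  fix \<psi>' assume \<psi>': "\<psi>' \<in> mspace (X_space a b \<tau>\<^sub>0) \<and> has_X_derivative a b \<tau>\<^sub>0 \<phi> \<psi>'"
  show "\<psi>' = \<psi>"
  proof (rule X_eqI)
    fix t r assume tr: "t \<in> H" "r \<in> D"
    have "((\<lambda>u. \<phi> u r) has_vector_derivative \<psi> t r) (at t within H)"
      using assms has_X_derivative_iff[OF assms(1,2)] tr by blast
    moreover have "((\<lambda>u. \<phi> u r) has_vector_derivative \<psi>' t r) (at t within H)"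
      using \<psi>' has_X_derivative_iff[OF assms(1), of \<psi>'] tr by blast
    moreover have "- (\<tau>\<^sub>0 + 2 * a + 2 * b) < 0" using a b \<tau>\<^sub>0 by simp
    ultimately show "\<psi>' t r = \<psi> t r"
      using vector_derivative_within_closed_interval tr(1) unfolding hist_interval_def by metis
  qed (use assms \<psi>' in auto)
qed

lemma delay_in_hist:
  assumes "r \<in> D" "r' \<in> D"
  shows "- \<tau>\<^sub>0 - norm1 (r - r') \<in> H"
  using assms \<tau>\<^sub>0 by (auto simp: Omega_bar_def hist_interval_def norm1_def)

end

section \<open>From the characteristic equation to the spectrum of the generator\<close>

locale delayed_field = delayed_rectangle +
  fixes \<alpha> s :: real and ch \<xi> z :: complex
begin

text \<open>
  The operator \<open>DG(0)\<close> with a gauge integral over the closed rectangle; it agrees with the Lebesgue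
  integral over the interior because the integrands are continuous and the boundary is null.
\<close>

definition delay_term :: "(real \<Rightarrow> real \<times> real \<Rightarrow> complex) \<Rightarrow> real \<times> real \<Rightarrow> complex" where
  "delay_term h r = of_real s *
     integral D (\<lambda>r'. J_kernel ch \<xi> r r' * h (- \<tau>\<^sub>0 - norm1 (r - r')) r')"

abbreviation char_kernel where
  "char_kernel \<equiv> exp_kernel (c_fun \<tau>\<^sub>0 s ch z) (k_fun \<xi> z)"

text \<open>
  The part \<open>h\<^sub>f\<close> of the solution of \<open>(z - A) \<phi> = f\<close> that vanishes at time \<open>0\<close>.
\<close>

definition duhamel :: "(real \<Rightarrow> real \<times> real \<Rightarrow> complex) \<Rightarrow> real \<Rightarrow> real \<times> real \<Rightarrow> complex" where
  "duhamel f t r = past_integral z (\<lambda>u. f u r) t"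

text \<open>
  The right-hand side \<open>f(0) + DG(0) h\<^sub>f\<close> of the characteristic equation for \<open>\<phi>(0)\<close>.
\<close>

definition source :: "(real \<Rightarrow> real \<times> real \<Rightarrow> complex) \<Rightarrow> real \<times> real \<Rightarrow> complex" where
  "source f r = f 0 r + delay_term (duhamel f) r"

lemma continuous_on_delayed_integrand:
  assumes "continuous_on (H \<times> D) (\<lambda>p. h (fst p) (snd p))"
  shows "continuous_on (D \<times> D)
    (\<lambda>p. J_kernel ch \<xi> (fst p) (snd p) * h (- \<tau>\<^sub>0 - norm1 (fst p - snd p)) (snd p))"
proof -
  have c: "continuous_on (D \<times> D) (\<lambda>p. - \<tau>\<^sub>0 - norm1 (fst p - snd p))"
    unfolding norm1_def by (intro continuous_intros)
  have "continuous_on (D \<times> D) (\<lambda>p. h (- \<tau>\<^sub>0 - norm1 (fst p - snd p)) (snd p))"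
    using continuous_on_compose2[OF assms continuous_on_Pair[OF c continuous_on_snd[OF continuous_on_id]]]
      delay_in_hist by force
  moreover have "continuous_on (D \<times> D) (\<lambda>p. J_kernel ch \<xi> (fst p) (snd p))"
    unfolding J_kernel_def norm1_def by (intro continuous_intros)
  ultimately show ?thesis by (intro continuous_on_mult)
qed

lemma continuous_on_delayed_slice:
  assumes "continuous_on (H \<times> D) (\<lambda>p. h (fst p) (snd p))" "r \<in> D"
  shows "continuous_on D (\<lambda>r'. J_kernel ch \<xi> r r' * h (- \<tau>\<^sub>0 - norm1 (r - r')) r')"
  using continuous_on_slice[OF continuous_on_delayed_integrand[OF assms(1)] assms(2)] by simp

lemma continuous_on_delay_term:
  assumes "continuous_on (H \<times> D) (\<lambda>p. h (fst p) (snd p))"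
  shows "continuous_on D (delay_term h)"
proof -
  have "continuous_on D (\<lambda>r. integral D (\<lambda>r'. J_kernel ch \<xi> r r' * h (- \<tau>\<^sub>0 - norm1 (r - r')) r'))"
    unfolding Omega_bar_cbox
    using continuous_on_delayed_integrand[OF assms]
    by (intro integral_continuous_on_param) (simp add: case_prod_unfold Omega_bar_cbox)
  then show ?thesis unfolding delay_term_def[abs_def] by (intro continuous_intros)
qed

lemma delay_term_cong:
  assumes "\<And>t r. t \<in> H \<Longrightarrow> r \<in> D \<Longrightarrow> h t r = h' t r" "r \<in> D"
  shows "delay_term h r = delay_term h' r"
  unfolding delay_term_def
  by (intro arg_cong2[where f="(*)"] refl integral_cong) (use assms delay_in_hist in auto)

lemma DG0_eq_delay_term:
  assumes "\<phi> \<in> mspace (X_space a b \<tau>\<^sub>0)" "r \<in> D"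
  shows "DG0 a b \<tau>\<^sub>0 s ch \<xi> \<phi> r = delay_term \<phi> r"
  using integral_Omega[OF continuous_on_delayed_slice[OF X_continuous[OF assms(1)] assms(2)]] assms(2)
  by (simp add: DG0_def delay_term_def)

text \<open>
  On \<open>exp (z t) q\<close> the delay \<open>\<tau>\<^sub>0 + \<parallel>r - r'\<parallel>\<^sub>1\<close> contributes \<open>exp (- z \<tau>\<^sub>0)\<close> to the coefficient \<open>c(z)\<close> and
  turns \<open>\<xi>\<close> into \<open>k(z) = z + \<xi>\<close> in the exponent.
\<close>

lemma delay_term_exp:
  assumes q: "continuous_on D q" and h: "continuous_on (H \<times> D) (\<lambda>p. h (fst p) (snd p))" and r: "r \<in> D"
  shows "delay_term (\<lambda>t r. exp (z * of_real t) * q r + h t r) r =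
    integral D (\<lambda>r'. char_kernel (r, r') * q r') + delay_term h r"
proof -
  let ?E = "\<lambda>r'. J_kernel ch \<xi> r r' * (exp (z * of_real (- \<tau>\<^sub>0 - norm1 (r - r'))) * q r')"
  let ?h = "\<lambda>r'. J_kernel ch \<xi> r r' * h (- \<tau>\<^sub>0 - norm1 (r - r')) r'"
  have kern: "char_kernel (r, r') * q r' = of_real s * ?E r'" for r'
  proof -
    have "exp (- of_real \<tau>\<^sub>0 * z) * exp (- k_fun \<xi> z * of_real (norm1 (r - r'))) =
        exp (- \<xi> * of_real (norm1 (r - r'))) * exp (z * of_real (- \<tau>\<^sub>0 - norm1 (r - r')))"
      by (simp add: k_fun_def algebra_simps flip: exp_add)
    then show ?thesis by (simp add: exp_kernel_def c_fun_def J_kernel_def mult_ac)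
  qed
  have E: "continuous_on D ?E"
    unfolding J_kernel_def norm1_def by (intro continuous_intros q)
  have "integral D (\<lambda>r'. ?E r' + ?h r') = integral D ?E + integral D ?h"
    using E continuous_on_delayed_slice[OF h r] unfolding Omega_bar_cbox
    by (intro integral_add integrable_continuous)
  then have "delay_term (\<lambda>t r. exp (z * of_real t) * q r + h t r) r =
      of_real s * integral D ?E + delay_term h r"
    by (simp add: delay_term_def distrib_left)
  also have "of_real s * integral D ?E = integral D (\<lambda>r'. of_real s * ?E r')" by simp
  also have "\<dots> = integral D (\<lambda>r'. char_kernel (r, r') * q r')" by (simp only: kern)
  finally show ?thesis .
qed

lemma delay_term_bound:
  "\<exists>N\<ge>0. \<forall>h C r. continuous_on (H \<times> D) (\<lambda>p. h (fst p) (snd p)) \<longrightarrow>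
      (\<forall>t\<in>H. \<forall>r\<in>D. norm (h t r) \<le> C) \<longrightarrow> r \<in> D \<longrightarrow> norm (delay_term h r) \<le> N * C"
proof -
  define V where "V = measure lborel D"
  have "continuous_on (D \<times> D) (\<lambda>p. J_kernel ch \<xi> (fst p) (snd p))"
    unfolding J_kernel_def norm1_def by (intro continuous_intros)
  from compact_imp_bounded[OF compact_continuous_image[OF this compact_Times[OF compact_Omega_bar compact_Omega_bar]]]
  obtain B where B: "\<And>r r'. r \<in> D \<Longrightarrow> r' \<in> D \<Longrightarrow> norm (J_kernel ch \<xi> r r') \<le> B"
    by (auto simp: bounded_iff)
  have B0: "0 \<le> B" using B[OF origin_in origin_in] norm_ge_zero order_trans by blast
  show ?thesis
  proof (intro exI[of _ "\<bar>s\<bar> * B * V"] conjI allI impI)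
    show "0 \<le> \<bar>s\<bar> * B * V" using B0 by (simp add: V_def measure_nonneg)
    fix h :: "real \<Rightarrow> real \<times> real \<Rightarrow> complex" and C r
    assume h: "continuous_on (H \<times> D) (\<lambda>p. h (fst p) (snd p))" and r: "r \<in> D"
      and "\<forall>t\<in>H. \<forall>r\<in>D. norm (h t r) \<le> C"
    then have C: "\<And>t r. t \<in> H \<Longrightarrow> r \<in> D \<Longrightarrow> norm (h t r) \<le> C" by blast
    have C0: "0 \<le> C" using C[OF zero_in_hist r] norm_ge_zero order_trans by blast
    have "norm (integral D (\<lambda>r'. J_kernel ch \<xi> r r' * h (- \<tau>\<^sub>0 - norm1 (r - r')) r')) \<le> (B * C) * V"
      unfolding Omega_bar_cbox V_def
    proof (rule has_integral_bound[OF _ integrable_integral[OF integrable_continuous]])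
      show "0 \<le> B * C" using B0 C0 by simp
      show "continuous_on (cbox (-a, -b) (a, b)) (\<lambda>r'. J_kernel ch \<xi> r r' * h (- \<tau>\<^sub>0 - norm1 (r - r')) r')"
        using continuous_on_delayed_slice[OF h r] by (simp only: Omega_bar_cbox)
      fix r' assume "r' \<in> cbox (-a, -b) (a, b)"
      then have r': "r' \<in> D" by (simp only: Omega_bar_cbox)
      show "norm (J_kernel ch \<xi> r r' * h (- \<tau>\<^sub>0 - norm1 (r - r')) r') \<le> B * C"
        unfolding norm_mult
        by (rule mult_mono[OF B[OF r r'] C[OF delay_in_hist[OF r r'] r'] B0 norm_ge_zero])
    qed
    then have "\<bar>s\<bar> * norm (integral D (\<lambda>r'. J_kernel ch \<xi> r r' * h (- \<tau>\<^sub>0 - norm1 (r - r')) r')) \<le> \<bar>s\<bar> * ((B * C) * V)"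
      by (rule mult_left_mono) simp
    then show "norm (delay_term h r) \<le> \<bar>s\<bar> * B * V * C"
      by (simp add: delay_term_def norm_mult mult_ac)
  qed
qed

lemma continuous_on_duhamel:
  assumes "f \<in> mspace (X_space a b \<tau>\<^sub>0)"
  shows "continuous_on (H \<times> D) (\<lambda>p. duhamel f (fst p) (snd p))"
  using X_continuous[OF assms] unfolding hist_interval_def duhamel_def
  by (rule continuous_on_past_integral)

lemma duhamel_deriv:
  assumes "f \<in> mspace (X_space a b \<tau>\<^sub>0)" "t \<in> H" "r \<in> D"
  shows "((\<lambda>t. duhamel f t r) has_vector_derivative z * duhamel f t r - f t r) (at t within H)"
  using past_integral_deriv[OF X_continuous_slices(2)[OF assms(1,3), unfolded hist_interval_def]
    assms(2)[unfolded hist_interval_def], of z]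
  unfolding duhamel_def hist_interval_def .

lemma continuous_on_source:
  assumes "f \<in> mspace (X_space a b \<tau>\<^sub>0)"
  shows "continuous_on D (source f)"
  unfolding source_def[abs_def]
  by (intro continuous_on_add X_continuous_slices(1)[OF assms zero_in_hist]
      continuous_on_delay_term continuous_on_duhamel[OF assms])

lemma duhamel_source_bound:
  "\<exists>N\<ge>0. \<forall>f C t r. f \<in> mspace (X_space a b \<tau>\<^sub>0) \<longrightarrow> (\<forall>t\<in>H. \<forall>r\<in>D. norm (f t r) \<le> C) \<longrightarrow>
       t \<in> H \<longrightarrow> r \<in> D \<longrightarrow> norm (duhamel f t r) \<le> N * C \<and> norm (source f r) \<le> N * C"
proof -
  define T where "T = \<tau>\<^sub>0 + 2 * a + 2 * b"
  define K where "K = exp (norm z * T) * T"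
  have K0: "K \<ge> 0" using a b \<tau>\<^sub>0 by (simp add: K_def T_def)
  obtain N where N: "N \<ge> 0" "\<forall>h C r. continuous_on (H \<times> D) (\<lambda>p. h (fst p) (snd p)) \<longrightarrow>
      (\<forall>t\<in>H. \<forall>r\<in>D. norm (h t r) \<le> C) \<longrightarrow> r \<in> D \<longrightarrow> norm (delay_term h r) \<le> N * C"
    using delay_term_bound by blast
  show ?thesis
  proof (intro exI[of _ "K + (1 + N * K)"] conjI[of "0 \<le> _"] allI impI)
    show "0 \<le> K + (1 + N * K)" using K0 N(1) by simp
    fix f C t r
    assume f: "f \<in> mspace (X_space a b \<tau>\<^sub>0)" and "\<forall>t\<in>H. \<forall>r\<in>D. norm (f t r) \<le> C"
      and t: "t \<in> H" and r: "r \<in> D"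
    then have C: "\<And>t r. t \<in> H \<Longrightarrow> r \<in> D \<Longrightarrow> norm (f t r) \<le> C" by blast
    have C0: "0 \<le> C" using C[OF t r] norm_ge_zero order_trans by blast
    have d: "norm (duhamel f t r) \<le> K * C" if "t \<in> H" "r \<in> D" for t r
      unfolding duhamel_def K_def T_def
      using X_continuous_slices(2)[OF f that(2)] that C unfolding hist_interval_def
      by (intro past_integral_bound) auto
    have "norm (source f r) \<le> norm (f 0 r) + norm (delay_term (duhamel f) r)"
      unfolding source_def by (rule norm_triangle_ineq)
    also have "\<dots> \<le> C + N * (K * C)"
      by (intro add_mono C[OF zero_in_hist r] N(2)[rule_format, OF continuous_on_duhamel[OF f] d r])
    finally have "norm (source f r) \<le> (1 + N * K) * C" by (simp add: algebra_simps)
    moreover have "K * C \<ge> 0" "N * (K * C) \<ge> 0" using K0 C0 N(1) by simp_all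
    ultimately show "norm (duhamel f t r) \<le> (K + (1 + N * K)) * C \<and> norm (source f r) \<le> (K + (1 + N * K)) * C"
      using d[OF t r] C0 by (simp add: algebra_simps)
  qed
qed

text \<open>
  Both \<open>\<phi>(_, r)\<close> and \<open>h\<^sub>f(_, r)\<close> solve \<open>u' = z u - f\<close>, so they differ by a multiple of \<open>exp (z t)\<close>.
  Inserting this into the boundary condition of the domain gives the characteristic equation.
\<close>

lemma dom_A_representation:
  assumes "\<phi> \<in> dom_A a b \<alpha> \<tau>\<^sub>0 s ch \<xi>"
  defines "f \<equiv> z_minus_A a b \<tau>\<^sub>0 z \<phi>"
  shows "\<phi> \<in> mspace (X_space a b \<tau>\<^sub>0)" and "f \<in> mspace (X_space a b \<tau>\<^sub>0)"
    and "\<And>t r. t \<in> H \<Longrightarrow> r \<in> D \<Longrightarrow> \<phi> t r = exp (z * of_real t) * \<phi> 0 r + duhamel f t r"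
    and "\<And>r. r \<in> D \<Longrightarrow>
      (z + of_real \<alpha>) * \<phi> 0 r - integral D (\<lambda>r'. char_kernel (r, r') * \<phi> 0 r') = source f r"
proof -
  from assms(1) obtain \<psi> where \<phi>: "\<phi> \<in> mspace (X_space a b \<tau>\<^sub>0)" and \<psi>: "\<psi> \<in> mspace (X_space a b \<tau>\<^sub>0)"
    and d: "has_X_derivative a b \<tau>\<^sub>0 \<phi> \<psi>"
    and \<psi>0: "\<psi> 0 = (\<lambda>r\<in>D. - of_real \<alpha> * \<phi> 0 r + DG0 a b \<tau>\<^sub>0 s ch \<xi> \<phi> r)"
    unfolding dom_A_def by blast
  show \<phi>X: "\<phi> \<in> mspace (X_space a b \<tau>\<^sub>0)" by (rule \<phi>)
  have f_eq: "f = (\<lambda>t\<in>H. \<lambda>r\<in>D. z * \<phi> t r - \<psi> t r)"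
    by (simp add: f_def z_minus_A_def A_op_eqI[OF \<phi> \<psi> d])
  show f: "f \<in> mspace (X_space a b \<tau>\<^sub>0)"
    unfolding f_eq by (intro restrict_in_X continuous_intros X_continuous \<phi> \<psi>)
  show rep: "\<phi> t r = exp (z * of_real t) * \<phi> 0 r + duhamel f t r" if t: "t \<in> H" and r: "r \<in> D" for t r
  proof -
    have "\<phi> t r = exp (z * of_real t) * (\<phi> 0 r - duhamel f 0 r) + duhamel f t r"
    proof (rule solution_linear_ode)
      have H: "{- (\<tau>\<^sub>0 + 2 * a + 2 * b)..0} = H" by (simp only: hist_interval_def)
      show "0 \<le> \<tau>\<^sub>0 + 2 * a + 2 * b" using a b \<tau>\<^sub>0 by simp
      show "t \<in> {- (\<tau>\<^sub>0 + 2 * a + 2 * b)..0}" using t by (simp add: hist_interval_def)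
      fix u assume "u \<in> {- (\<tau>\<^sub>0 + 2 * a + 2 * b)..0}"
      then have u: "u \<in> H" by (simp add: hist_interval_def)
      have "((\<lambda>t. \<phi> t r) has_vector_derivative \<psi> u r) (at u within H)"
        using d has_X_derivative_iff[OF \<phi> \<psi>] u r by blast
      then show "((\<lambda>t. \<phi> t r) has_vector_derivative z * \<phi> u r - f u r) (at u within {- (\<tau>\<^sub>0 + 2 * a + 2 * b)..0})"
        unfolding H using u r by (simp add: f_eq)
      show "((\<lambda>t. duhamel f t r) has_vector_derivative z * duhamel f u r - f u r) (at u within {- (\<tau>\<^sub>0 + 2 * a + 2 * b)..0})"
        unfolding H by (rule duhamel_deriv[OF f u r])
    qed
    then show ?thesis by (simp add: duhamel_def)
  qed
  show "(z + of_real \<alpha>) * \<phi> 0 r - integral D (\<lambda>r'. char_kernel (r, r') * \<phi> 0 r') = source f r" if r: "r \<in> D" for r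
  proof -
    have "delay_term \<phi> r = delay_term (\<lambda>t r. exp (z * of_real t) * \<phi> 0 r + duhamel f t r) r"
      by (rule delay_term_cong[OF rep r])
    also have "\<dots> = integral D (\<lambda>r'. char_kernel (r, r') * \<phi> 0 r') + delay_term (duhamel f) r"
      by (rule delay_term_exp[OF X_continuous_slices(1)[OF \<phi> zero_in_hist] continuous_on_duhamel[OF f] r])
    finally have \<psi>0r: "\<psi> 0 r = - of_real \<alpha> * \<phi> 0 r +
        (integral D (\<lambda>r'. char_kernel (r, r') * \<phi> 0 r') + delay_term (duhamel f) r)"
      using r by (simp add: \<psi>0 DG0_eq_delay_term[OF \<phi> r])
    have f0r: "f 0 r = z * \<phi> 0 r - \<psi> 0 r" using r zero_in_hist by (simp add: f_eq)
    show ?thesis unfolding source_def f0r \<psi>0r by (simp add: algebra_simps)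
  qed
qed

text \<open>
  The converse: the derivative of \<open>\<phi>\<close> is \<open>z \<phi> - f\<close>, and the characteristic equation for \<open>q\<close> is the
  boundary condition.
\<close>

lemma dom_A_construction:
  assumes f: "f \<in> mspace (X_space a b \<tau>\<^sub>0)" and q: "continuous_on D q"
    and eq: "\<forall>r\<in>D.
      (z + of_real \<alpha>) * q r - integral D (\<lambda>r'. char_kernel (r, r') * q r') = source f r"
  defines "\<phi> \<equiv> (\<lambda>t\<in>H. \<lambda>r\<in>D. exp (z * of_real t) * q r + duhamel f t r)"
  shows "\<phi> \<in> dom_A a b \<alpha> \<tau>\<^sub>0 s ch \<xi>"
    and "A_op a b \<tau>\<^sub>0 \<phi> = (\<lambda>t\<in>H. \<lambda>r\<in>D. z * \<phi> t r - f t r)"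
    and "z_minus_A a b \<tau>\<^sub>0 z \<phi> = f"
proof -
  define \<psi> where "\<psi> = (\<lambda>t\<in>H. \<lambda>r\<in>D. z * \<phi> t r - f t r)"
  have val: "\<phi> t r = exp (z * of_real t) * q r + duhamel f t r" if "t \<in> H" "r \<in> D" for t r
    using that by (simp add: \<phi>_def)
  have "continuous_on (H \<times> D) (\<lambda>p. q (snd p))"
    by (rule continuous_on_compose2[OF q continuous_on_snd[OF continuous_on_id]]) auto
  then have \<phi>: "\<phi> \<in> mspace (X_space a b \<tau>\<^sub>0)"
    unfolding \<phi>_def by (intro restrict_in_X continuous_intros continuous_on_duhamel[OF f])
  have \<psi>: "\<psi> \<in> mspace (X_space a b \<tau>\<^sub>0)"
    unfolding \<psi>_def by (intro restrict_in_X continuous_intros X_continuous \<phi> f)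
  have d: "has_X_derivative a b \<tau>\<^sub>0 \<phi> \<psi>"
    unfolding has_X_derivative_iff[OF \<phi> \<psi>]
  proof (intro ballI)
    fix t r assume t: "t \<in> H" and r: "r \<in> D"
    have E: "((\<lambda>x. exp (z * of_real x)) has_vector_derivative z * exp (z * of_real t)) (at t within S)" for S
      by (rule has_vector_derivative_real_field) (auto intro!: derivative_eq_intros)
    have "((\<lambda>t. exp (z * of_real t) * q r + duhamel f t r) has_vector_derivative
        z * exp (z * of_real t) * q r + (z * duhamel f t r - f t r)) (at t within H)"
      by (intro has_vector_derivative_add has_vector_derivative_mult_left E duhamel_deriv f t r)
    also have "z * exp (z * of_real t) * q r + (z * duhamel f t r - f t r) = \<psi> t r"
      using t r by (simp add: \<psi>_def val algebra_simps)
    finally show "((\<lambda>u. \<phi> u r) has_vector_derivative \<psi> t r) (at t within H)"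
      by (rule has_vector_derivative_transform[OF t val[OF _ r], rotated])
  qed
  have "\<psi> 0 r = - of_real \<alpha> * \<phi> 0 r + DG0 a b \<tau>\<^sub>0 s ch \<xi> \<phi> r" if r: "r \<in> D" for r
  proof -
    have "DG0 a b \<tau>\<^sub>0 s ch \<xi> \<phi> r = delay_term (\<lambda>t r. exp (z * of_real t) * q r + duhamel f t r) r"
      unfolding DG0_eq_delay_term[OF \<phi> r] by (rule delay_term_cong[OF val r])
    also have "\<dots> = integral D (\<lambda>r'. char_kernel (r, r') * q r') + delay_term (duhamel f) r"
      by (rule delay_term_exp[OF q continuous_on_duhamel[OF f] r])
    also have "\<dots> = (z + of_real \<alpha>) * q r - f 0 r"
      using eq[rule_format, OF r] by (simp add: source_def diff_eq_eq add_ac)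
    finally show ?thesis
      using r zero_in_hist by (simp add: \<psi>_def val duhamel_def algebra_simps)
  qed
  then have "\<psi> 0 = (\<lambda>r\<in>D. - of_real \<alpha> * \<phi> 0 r + DG0 a b \<tau>\<^sub>0 s ch \<xi> \<phi> r)"
    using \<psi> zero_in_hist by (intro extensionalityI[of _ D]) (auto simp: mspace_X_iff)
  then show "\<phi> \<in> dom_A a b \<alpha> \<tau>\<^sub>0 s ch \<xi>" using \<phi> \<psi> d unfolding dom_A_def by blast
  show A: "A_op a b \<tau>\<^sub>0 \<phi> = (\<lambda>t\<in>H. \<lambda>r\<in>D. z * \<phi> t r - f t r)"
    using A_op_eqI[OF \<phi> \<psi> d] by (simp only: \<psi>_def)
  have "z_minus_A a b \<tau>\<^sub>0 z \<phi> \<in> mspace (X_space a b \<tau>\<^sub>0)"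
    unfolding z_minus_A_def A by (intro restrict_in_X continuous_intros X_continuous \<phi> \<psi>[unfolded \<psi>_def])
  then show "z_minus_A a b \<tau>\<^sub>0 z \<phi> = f"
    by (rule X_eqI[OF _ f]) (simp add: z_minus_A_def A)
qed

text \<open>
  The preimage of \<open>f\<close> under \<open>z - A\<close> is determined by its value at time \<open>0\<close>, the unique solution of the
  characteristic equation with right-hand side \<open>source f\<close>; all maps in this construction are bounded.
\<close>

theorem resolvent_set_if_characteristic_equation_solvable:
  assumes inj: "\<And>q r. continuous_on D q \<Longrightarrow>
      (\<And>r. r \<in> D \<Longrightarrow> (z + of_real \<alpha>) * q r = integral D (\<lambda>r'. char_kernel (r, r') * q r')) \<Longrightarrow>
      r \<in> D \<Longrightarrow> q r = 0"
    and solve: "\<And>g C. continuous_on D g \<Longrightarrow> \<forall>r\<in>D. norm (g r) \<le> C \<Longrightarrow>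
      \<exists>q. continuous_on D q \<and> (\<forall>r\<in>D. norm (q r) \<le> M * C) \<and>
        (\<forall>r\<in>D. (z + of_real \<alpha>) * q r - integral D (\<lambda>r'. char_kernel (r, r') * q r') = g r)"
  shows "z \<in> resolvent_set_A a b \<alpha> \<tau>\<^sub>0 s ch \<xi>"
proof -
  have uniq: "q r = q' r"
    if q: "continuous_on D q" and q': "continuous_on D q'" and r: "r \<in> D"
      and e: "\<And>r. r \<in> D \<Longrightarrow> (z + of_real \<alpha>) * q r - integral D (\<lambda>r'. char_kernel (r, r') * q r') = g r"
      and e': "\<And>r. r \<in> D \<Longrightarrow> (z + of_real \<alpha>) * q' r - integral D (\<lambda>r'. char_kernel (r, r') * q' r') = g r"
    for q q' g r
  proof -
    have "q r - q' r = 0"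
    proof (rule inj[OF continuous_on_diff[OF q q'] _ r])
      fix r assume r: "r \<in> D"
      have int: "(\<lambda>r'. char_kernel (r, r') * p r') integrable_on D" if "continuous_on D p" for p
        using that continuous_on_slice[OF continuous_on_exp_kernel r] unfolding Omega_bar_cbox
        by (intro integrable_continuous continuous_on_mult)
      show "(z + of_real \<alpha>) * (q r - q' r) = integral D (\<lambda>r'. char_kernel (r, r') * (q r' - q' r'))"
        using e[OF r] e'[OF r] integral_diff[OF int[OF q] int[OF q']]
        by (simp add: right_diff_distrib algebra_simps)
    qed
    then show ?thesis by simp
  qed
  have bij: "bij_betw (z_minus_A a b \<tau>\<^sub>0 z) (dom_A a b \<alpha> \<tau>\<^sub>0 s ch \<xi>) (mspace (X_space a b \<tau>\<^sub>0))"
    unfolding bij_betw_def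
  proof (intro conjI inj_onI equalityI subsetI)
    fix \<phi> \<phi>' assume \<phi>: "\<phi> \<in> dom_A a b \<alpha> \<tau>\<^sub>0 s ch \<xi>" and \<phi>': "\<phi>' \<in> dom_A a b \<alpha> \<tau>\<^sub>0 s ch \<xi>"
      and eq: "z_minus_A a b \<tau>\<^sub>0 z \<phi> = z_minus_A a b \<tau>\<^sub>0 z \<phi>'"
    note rep = dom_A_representation[OF \<phi>] and rep' = dom_A_representation[OF \<phi>', folded eq]
    have 0: "\<phi> 0 r = \<phi>' 0 r" if "r \<in> D" for r
      by (rule uniq[OF X_continuous_slices(1)[OF rep(1) zero_in_hist]
          X_continuous_slices(1)[OF rep'(1) zero_in_hist] that rep(4) rep'(4)])
    show "\<phi> = \<phi>'"
    proof (rule X_eqI[OF rep(1) rep'(1)])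
      fix t r assume "t \<in> H" "r \<in> D"
      then show "\<phi> t r = \<phi>' t r" by (simp only: rep(3)[of t r] rep'(3)[of t r] 0[of r])
    qed
  next
    fix f assume "f \<in> z_minus_A a b \<tau>\<^sub>0 z ` dom_A a b \<alpha> \<tau>\<^sub>0 s ch \<xi>"
    then show "f \<in> mspace (X_space a b \<tau>\<^sub>0)" using dom_A_representation(2) by blast
  next
    fix f assume f: "f \<in> mspace (X_space a b \<tau>\<^sub>0)"
    obtain C where "\<forall>r\<in>D. norm (source f r) \<le> C"
      using compact_imp_bounded[OF compact_continuous_image[OF continuous_on_source[OF f] compact_Omega_bar]]
      by (auto simp: bounded_iff)
    from solve[OF continuous_on_source[OF f] this] obtain q where q: "continuous_on D q"
      "\<forall>r\<in>D. (z + of_real \<alpha>) * q r - integral D (\<lambda>r'. char_kernel (r, r') * q r') = source f r"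
      by blast
    note con = dom_A_construction[OF f q(1) q(2)]
    show "f \<in> z_minus_A a b \<tau>\<^sub>0 z ` dom_A a b \<alpha> \<tau>\<^sub>0 s ch \<xi>"
      using imageI[OF con(1), of "z_minus_A a b \<tau>\<^sub>0 z"] unfolding con(3) .
  qed
  obtain N where N: "N \<ge> 0"
    "\<forall>f C t r. f \<in> mspace (X_space a b \<tau>\<^sub>0) \<longrightarrow> (\<forall>t\<in>H. \<forall>r\<in>D. norm (f t r) \<le> C) \<longrightarrow>
       t \<in> H \<longrightarrow> r \<in> D \<longrightarrow> norm (duhamel f t r) \<le> N * C \<and> norm (source f r) \<le> N * C"
    using duhamel_source_bound by blast
  define E where "E = exp (norm z * (\<tau>\<^sub>0 + 2 * a + 2 * b))"
  have "norm_X a b \<tau>\<^sub>0 \<phi> \<le> (E * (M * N) + N) * norm_X a b \<tau>\<^sub>0 (z_minus_A a b \<tau>\<^sub>0 z \<phi>)"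
    if \<phi>: "\<phi> \<in> dom_A a b \<alpha> \<tau>\<^sub>0 s ch \<xi>" for \<phi>
  proof -
    define f where "f = z_minus_A a b \<tau>\<^sub>0 z \<phi>"
    note rep = dom_A_representation[OF \<phi>, folded f_def]
    define C where "C = norm_X a b \<tau>\<^sub>0 f"
    have "\<forall>t\<in>H. \<forall>r\<in>D. norm (f t r) \<le> C"
      using norm_X_le_iff[OF rep(2), of C] by (simp add: C_def)
    then have NC: "norm (duhamel f t r) \<le> N * C \<and> norm (source f r) \<le> N * C" if "t \<in> H" "r \<in> D" for t r
      using N(2) rep(2) that by blast
    have "\<forall>r\<in>D. norm (source f r) \<le> N * C" using NC[OF zero_in_hist] by blast
    from solve[OF continuous_on_source[OF rep(2)] this] obtain q where q: "continuous_on D q"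
      "\<forall>r\<in>D. norm (q r) \<le> M * (N * C)"
      "\<forall>r\<in>D. (z + of_real \<alpha>) * q r - integral D (\<lambda>r'. char_kernel (r, r') * q r') = source f r"
      by blast
    have q0: "\<phi> 0 r = q r" if "r \<in> D" for r
      by (rule uniq[OF X_continuous_slices(1)[OF rep(1) zero_in_hist] q(1) that rep(4) q(3)[rule_format]])
    have "norm (\<phi> t r) \<le> (E * (M * N) + N) * C" if t: "t \<in> H" and r: "r \<in> D" for t r
    proof -
      have "\<bar>t\<bar> \<le> \<tau>\<^sub>0 + 2 * a + 2 * b" using t by (auto simp: hist_interval_def)
      then have "norm z * \<bar>t\<bar> \<le> norm z * (\<tau>\<^sub>0 + 2 * a + 2 * b)" by (rule mult_left_mono) simp
      then have le: "norm (z * of_real t) \<le> norm z * (\<tau>\<^sub>0 + 2 * a + 2 * b)" by (simp add: norm_mult)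
      have "norm (exp (z * of_real t)) \<le> exp (norm (z * of_real t))" by (rule norm_exp)
      also have "\<dots> \<le> E" using le unfolding E_def by simp
      finally have e: "norm (exp (z * of_real t)) \<le> E" .
      have "norm (\<phi> t r) \<le> norm (exp (z * of_real t) * q r) + norm (duhamel f t r)"
        unfolding rep(3)[OF t r] q0[OF r] by (rule norm_triangle_ineq)
      also have "\<dots> \<le> E * (M * (N * C)) + N * C"
        unfolding norm_mult
        using q(2) r NC[OF t r] e by (intro add_mono mult_mono) (auto simp: E_def)
      finally show ?thesis by (simp add: algebra_simps)
    qed
    then show ?thesis using norm_X_le_iff[OF rep(1)] by (simp add: C_def f_def)
  qed
  with bij show ?thesis unfolding resolvent_set_A_def by blast
qed

text \<open>
  The case \<open>f = 0\<close> of the construction of solutions of \<open>(z - A) \<phi> = f\<close>.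
\<close>

theorem eigenvector_if_characteristic_equation:
  assumes q: "q \<in> mspace (Y_space a b)" and ne: "q \<noteq> zero_Y a b"
    and eq: "\<And>r. r \<in> D \<Longrightarrow> (z + of_real \<alpha>) * q r = integral D (\<lambda>r'. char_kernel (r, r') * q r')"
  shows "in_point_spectrum_with a b \<alpha> \<tau>\<^sub>0 s ch \<xi> z q"
proof -
  let ?\<phi> = "\<lambda>t\<in>H. \<lambda>r\<in>D. exp (z * of_real t) * q r"
  have duh: "duhamel (zero_X a b \<tau>\<^sub>0) t r = 0" if "t \<in> H" "r \<in> D" for t r
  proof -
    have "duhamel (zero_X a b \<tau>\<^sub>0) t r = integral {t..0} (\<lambda>s. 0)"
      unfolding duhamel_def past_integral_def
      by (rule integral_cong) (use that in \<open>auto simp: zero_X_def zero_Y_def hist_interval_def\<close>)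
    then show ?thesis by simp
  qed
  have src: "source (zero_X a b \<tau>\<^sub>0) r = 0" if "r \<in> D" for r
  proof -
    have "delay_term (duhamel (zero_X a b \<tau>\<^sub>0)) r = delay_term (\<lambda>t r. 0) r"
      by (rule delay_term_cong[OF duh that])
    then show ?thesis
      using that zero_in_hist by (simp add: source_def delay_term_def zero_X_def zero_Y_def)
  qed
  have \<phi>: "(\<lambda>t\<in>H. \<lambda>r\<in>D. exp (z * of_real t) * q r + duhamel (zero_X a b \<tau>\<^sub>0) t r) = ?\<phi>"
    by (intro restrict_ext) (simp add: duh)
  have qc: "continuous_on D q" using q by (simp add: mspace_Y_iff)
  have e: "\<forall>r\<in>D. (z + of_real \<alpha>) * q r - integral D (\<lambda>r'. char_kernel (r, r') * q r') =
      source (zero_X a b \<tau>\<^sub>0) r"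
    using eq src by simp
  note con = dom_A_construction[OF zero_X_in qc e, unfolded \<phi>]
  obtain r where r: "r \<in> D" "q r \<noteq> 0"
    using ne q unfolding mspace_Y_iff zero_Y_def by (metis extensionalityI restrict_apply' restrict_extensional)
  have "?\<phi> \<noteq> zero_X a b \<tau>\<^sub>0"
  proof
    assume "?\<phi> = zero_X a b \<tau>\<^sub>0"
    from fun_cong[OF fun_cong[OF this, of 0], of r] r show False
      using zero_in_hist by (simp add: zero_X_def zero_Y_def)
  qed
  moreover have "A_op a b \<tau>\<^sub>0 ?\<phi> = (\<lambda>t\<in>H. \<lambda>r\<in>D. z * ?\<phi> t r)"
    unfolding con(2) by (intro restrict_ext) (simp add: zero_X_def zero_Y_def)
  ultimately have "eigenvector_A a b \<alpha> \<tau>\<^sub>0 s ch \<xi> z ?\<phi>"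
    using con(1) unfolding eigenvector_A_def by blast
  then show ?thesis
    using q ne unfolding in_point_spectrum_with_def point_spectrum_A_def by blast
qed

end

section \<open>The spectral dichotomy\<close>

theorem theorem4p11:
  fixes a b \<alpha> \<tau>\<^sub>0 s :: real and ch \<xi> z :: complex
    and \<phi> \<psi> :: "nat \<Rightarrow> real \<Rightarrow> complex" and \<rho> \<nu> :: "nat \<Rightarrow> complex"
    and F :: "(nat \<times> nat) set filter"
  assumes "a > 0" and "b > 0" and "\<alpha> > 0" and "\<tau>\<^sub>0 > 0" and "s \<noteq> 0" and "ch \<noteq> 0"
    and "\<And>r r'. r \<in> Omega_bar a b \<Longrightarrow> r' \<in> Omega_bar a b \<Longrightarrow> J_kernel ch \<xi> r r' \<in> \<real>"
    and "z \<noteq> - of_real \<alpha>" and "k_fun \<xi> z \<noteq> 0"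
    and "\<And>m. C2_on {-a..a} (\<phi> m)" and "\<And>n. C2_on {-b..b} (\<psi> n)"
    and "L2_basis F (Omega a b) (\<lambda>(m, n). tensor a b (\<phi> m) (\<psi> n))"
    and "\<And>m. (k_fun \<xi> z)\<^sup>2 \<noteq> (\<rho> m)\<^sup>2" and "\<And>n. (k_fun \<xi> z)\<^sup>2 \<noteq> (\<nu> n)\<^sup>2"
    and "\<And>m n. L_op a b \<xi> z (tensor a b (\<phi> m) (\<psi> n)) =
           (\<lambda>r\<in>Omega_bar a b. ((k_fun \<xi> z)\<^sup>2 - (\<rho> m)\<^sup>2) * ((k_fun \<xi> z)\<^sup>2 - (\<nu> n)\<^sup>2) *
              tensor a b (\<phi> m) (\<psi> n) r)"
    and "\<And>m n. (\<lambda>r\<in>Omega_bar a b.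
             K_op a b \<tau>\<^sub>0 s ch \<xi> z (L_op a b \<xi> z (tensor a b (\<phi> m) (\<psi> n))) r
           - L_op a b \<xi> z (K_op a b \<tau>\<^sub>0 s ch \<xi> z (tensor a b (\<phi> m) (\<psi> n))) r) = zero_Y a b"
  shows "(\<forall>m n. P_fun \<alpha> \<tau>\<^sub>0 s ch \<xi> z (\<rho> m) (\<nu> n) = 0 \<longrightarrow>
            Delta_op a b \<alpha> \<tau>\<^sub>0 s ch \<xi> z (tensor a b (\<phi> m) (\<psi> n)) = zero_Y a b \<and>
            in_point_spectrum_with a b \<alpha> \<tau>\<^sub>0 s ch \<xi> z (tensor a b (\<phi> m) (\<psi> n))) \<and>
         ((\<forall>m n. P_fun \<alpha> \<tau>\<^sub>0 s ch \<xi> z (\<rho> m) (\<nu> n) \<noteq> 0) \<longrightarrow>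
            z \<in> resolvent_set_A a b \<alpha> \<tau>\<^sub>0 s ch \<xi>)"
proof -
  interpret delayed_field a b \<tau>\<^sub>0 \<alpha> s ch \<xi> z
    using assms(1,2,4) by unfold_locales
  let ?D = "Omega_bar a b" and ?c = "c_fun \<tau>\<^sub>0 s ch z" and ?k = "k_fun \<xi> z"
  define e where "e = (\<lambda>(m, n). tensor a b (\<phi> m) (\<psi> n))"
  define \<omega> where "\<omega> m n = (?k\<^sup>2 - (\<rho> m)\<^sup>2) * (?k\<^sup>2 - (\<nu> n)\<^sup>2)" for m n
  define \<theta> where "\<theta> = (\<lambda>(m, n). 4 * ?c * ?k\<^sup>2 / \<omega> m n)"
  have \<omega>: "\<omega> m n \<noteq> 0" for m n using assms(13)[of m] assms(14)[of n] by (simp add: \<omega>_def)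
  have c\<phi>: "continuous_on {-a..a} (\<phi> m)" and c\<psi>: "continuous_on {-b..b} (\<psi> n)" for m n
    using C2_on_continuous[OF assms(10)] C2_on_continuous[OF assms(11)] by auto
  have e: "continuous_on ?D (e i)" for i
    by (cases i) (simp add: e_def continuous_on_tensor c\<phi> c\<psi>)
  have basis: "L2_basis F (Omega a b) e" using assms(12) by (simp only: e_def)
  have K: "K_op a b \<tau>\<^sub>0 s ch \<xi> z (e i) r = \<theta> i * e i r" if "r \<in> ?D" for i r
  proof (cases i)
    case (Pair m n)
    show ?thesis
      using K_op_eigenfunction[OF assms(1,2) c\<phi> c\<psi> \<omega> assms(15)[of m n, folded \<omega>_def] assms(16) that]
      by (simp add: Pair e_def \<theta>_def)
  qed
  have eig: "integral ?D (\<lambda>r'. char_kernel (r, r') * e i r') = \<theta> i * e i r" if "r \<in> ?D" for i r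
    using K[OF that] K_op_eq[OF e that] by simp
  have P: "P_fun \<alpha> \<tau>\<^sub>0 s ch \<xi> z (\<rho> m) (\<nu> n) = 0 \<longleftrightarrow> z + of_real \<alpha> = \<theta> (m, n)" for m n
    using \<omega>[of m n] by (simp add: P_fun_def \<theta>_def \<omega>_def eq_divide_eq mult.assoc)
  have eigen: "Delta_op a b \<alpha> \<tau>\<^sub>0 s ch \<xi> z (e i) = zero_Y a b \<and>
      in_point_spectrum_with a b \<alpha> \<tau>\<^sub>0 s ch \<xi> z (e i)" if i: "z + of_real \<alpha> = \<theta> i" for i
  proof
    show "Delta_op a b \<alpha> \<tau>\<^sub>0 s ch \<xi> z (e i) = zero_Y a b"
      unfolding Delta_op_def zero_Y_def by (intro restrict_ext) (simp add: K i)
    obtain r where "r \<in> Omega a b" "e i r \<noteq> 0" using L2_basis_element_nonzero[OF basis] by blast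
    moreover from this have "r \<in> ?D" using interior_subset unfolding Omega_def by blast
    ultimately have ne: "e i \<noteq> zero_Y a b" by (auto simp: zero_Y_def)
    have "e i \<in> mspace (Y_space a b)"
      using e[of i] by (cases i) (simp add: mspace_Y_iff e_def tensor_def)
    then show "in_point_spectrum_with a b \<alpha> \<tau>\<^sub>0 s ch \<xi> z (e i)"
      by (rule eigenvector_if_characteristic_equation[OF _ ne]) (simp add: eig i)
  qed
  have resolvent: "z \<in> resolvent_set_A a b \<alpha> \<tau>\<^sub>0 s ch \<xi>"
    if ne: "\<And>i. z + of_real \<alpha> \<noteq> \<theta> i"
  proof -
    have inj: "q r = 0" if "continuous_on ?D q" "r \<in> ?D"
      "\<And>r. r \<in> ?D \<Longrightarrow> (z + of_real \<alpha>) * q r = integral ?D (\<lambda>r'. char_kernel (r, r') * q r')" for q r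
      by (rule injective_if_diagonal_on_L2_basis[OF assms(1,2) basis e continuous_on_exp_kernel eig ne that(1,3,2)])
    have "z + of_real \<alpha> \<noteq> 0" using assms(8) by (simp add: add_eq_0_iff2)
    from fredholm_alternative_kernel[OF _ continuous_on_exp_kernel this, of "(-a, -b)" "(a, b)", folded Omega_bar_cbox]
    obtain M where M: "\<forall>g C. continuous_on ?D g \<longrightarrow> (\<forall>r\<in>?D. norm (g r) \<le> C) \<longrightarrow>
      (\<exists>q. continuous_on ?D q \<and> (\<forall>r\<in>?D. norm (q r) \<le> M * C) \<and>
        (\<forall>r\<in>?D. (z + of_real \<alpha>) * q r - integral ?D (\<lambda>r'. char_kernel (r, r') * q r') = g r))"
      using origin_in inj by blast
    show ?thesis
    proof (rule resolvent_set_if_characteristic_equation_solvable[where M=M])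
      show "q r = 0" if "continuous_on ?D q" "r \<in> ?D"
        "\<And>r. r \<in> ?D \<Longrightarrow> (z + of_real \<alpha>) * q r = integral ?D (\<lambda>r'. char_kernel (r, r') * q r')" for q r
        by (rule inj[OF that])
    qed (use M in blast)
  qed
  show ?thesis
    using eigen[of "(_, _)"] resolvent P by (auto simp: e_def)
qed

end
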